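(* Let $n\ge 3$ and $\gamma_0,\dots,\gamma_n\in\{1,-1\}$. Then $\Gamma_e(\mathcal A_{n+1})$ contains exactly $2^n$ connected components if $\gamma_n=1$, and exactly $2^n-1$ connected components if $\gamma_n=-1$. Let $C$ be an arbitrary connected component of $\Gamma_e(\mathcal A_{n+1})$. Then the diameter of $C$ equals three. Moreover, the number of vertices of $C$ is $$|V(C)|=\begin{cases}2^{n+1}-2,&\chi(C)=1;\\ 2^{n+1}-4,&\chi(C)=-1.\end{cases}$$
   Context: Cayley–Dickson algebras: $\mathcal A_0=\mathbb R$ with trivial conjugation and basis element $e^{(0)}_0=1$. For $\gamma_k\in\{1,-1\}$, $\mathcal A_{k+1}=\mathcal A_k\{\gamma_k\}$ consists of pairs $(a,b)$ of elements of $\mathcal A_k$ with componentwise linear operations, product $(a,b)(c,d)=(ac+\gamma_k\bar d b,\ da+b\bar c)$ and conjugation $\overline{(a,b)}=(\bar a,-b)$. Write $\mathcal A_{n}=\mathcal A_{n}\{\gamma_0,\dots,\gamma_{n-1}\}$ and $\mathcal A_{n+1}=\mathcal A_{n+1}\{\gamma_0,\dots,\gamma_n\}$. The standard basis of $\mathcal A_{k+1}$ is $e^{(k+1)}_j=(e^{(k)}_j,0)$ for $0\le j<2^k$ and $e^{(k+1)}_j=(0,e^{(k)}_{j-2^k})$ for $2^k\le j<2^{k+1}$. $\mathcal E_n$ is the standard basis of $\mathcal A_n$, $e_0$ is the unit, $\mathcal E'_n=\mathcal E_n\setminus\{e_0\}$. The norm is $n(a)=a\bar a=\bar a a\in\mathbb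 R$; it equals $\pm1$ on $\pm\mathcal E_n$. Two elements $u,v$ of an algebra are orthogonal if $uv=vu=0$. The graph $\Gamma_e(\mathcal A_{n+1})$: vertices are the lines $\mathbb R(a,b)\subset\mathcal A_{n+1}$ spanned by zero divisors $(a,b)$ with $a\in\mathcal E'_n$, $b\in\pm\mathcal E_n$; two distinct lines are adjacent iff their generators are orthogonal. For a vertex $(a,b)$ put $\chi((a,b))=\gamma_n\,n(a)/n(b)\in\{1,-1\}$. It is known that $\chi$ is constant on each connected component $C$ of $\Gamma_e(\mathcal A_{n+1})$; its value is denoted $\chi(C)$ and called the characteristic of $C$. *)

theory Defs
  imports Complex_Main "Graph_Theory.Graph_Theory"
begin

section \<open>Cayley-Dickson algebras\<close>

text \<open>
  Elements of all the algebras live in one type of binary trees with real leaves; the algebra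
  $A_k$ is carried by the trees of uniform depth $k$. On trees of different shape the operations
  below are left unspecified. The parameters are a sequence \<open>\<gamma>\<close>, of which $A_k$ depends only on
  \<open>\<gamma> 0, \<dots>, \<gamma> (k - 1)\<close>.
\<close>

datatype cd = Scal real | Pr cd cd

primrec cd_carrier :: "nat \<Rightarrow> cd set" where
  "cd_carrier 0 = range Scal"
| "cd_carrier (Suc k) = {Pr a b | a b. a \<in> cd_carrier k \<and> b \<in> cd_carrier k}"

fun cd_add :: "cd \<Rightarrow> cd \<Rightarrow> cd" where
  "cd_add (Scal x) (Scal y) = Scal (x + y)"
| "cd_add (Pr a b) (Pr c d) = Pr (cd_add a c) (cd_add b d)"

primrec cd_scale :: "real \<Rightarrow> cd \<Rightarrow> cd" where
  "cd_scale r (Scal x) = Scal (r * x)"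
| "cd_scale r (Pr a b) = Pr (cd_scale r a) (cd_scale r b)"

abbreviation cd_uminus :: "cd \<Rightarrow> cd" where
  "cd_uminus \<equiv> cd_scale (- 1)"

primrec cd_zero :: "nat \<Rightarrow> cd" where
  "cd_zero 0 = Scal 0"
| "cd_zero (Suc k) = Pr (cd_zero k) (cd_zero k)"

primrec cd_cnj :: "cd \<Rightarrow> cd" where
  "cd_cnj (Scal x) = Scal x"
| "cd_cnj (Pr a b) = Pr (cd_cnj a) (cd_uminus b)"

fun cd_mult :: "(nat \<Rightarrow> real) \<Rightarrow> nat \<Rightarrow> cd \<Rightarrow> cd \<Rightarrow> cd" where
  "cd_mult \<gamma> 0 (Scal x) (Scal y) = Scal (x * y)"
| "cd_mult \<gamma> (Suc k) (Pr a b) (Pr c d) =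
     Pr (cd_add (cd_mult \<gamma> k a c) (cd_scale (\<gamma> k) (cd_mult \<gamma> k (cd_cnj d) b)))
        (cd_add (cd_mult \<gamma> k d a) (cd_mult \<gamma> k b (cd_cnj c)))"

primrec cd_basis :: "nat \<Rightarrow> nat \<Rightarrow> cd" where
  "cd_basis 0 j = Scal 1"
| "cd_basis (Suc k) j =
     (if j < 2 ^ k then Pr (cd_basis k j) (cd_zero k) else Pr (cd_zero k) (cd_basis k (j - 2 ^ k)))"

definition cd_E :: "nat \<Rightarrow> cd set" where
  "cd_E k = cd_basis k ` {..<2 ^ k}"

definition cd_E' :: "nat \<Rightarrow> cd set" where
  "cd_E' k = cd_E k - {cd_basis k 0}"

definition cd_pmE :: "nat \<Rightarrow> cd set" where
  "cd_pmE k = cd_E k \<union> cd_uminus ` cd_E k"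

text \<open>The norm is real-valued via the identification of $r$ with $r e_0$ (see \<open>cd_norm_eq\<close> below).\<close>

definition cd_norm :: "(nat \<Rightarrow> real) \<Rightarrow> nat \<Rightarrow> cd \<Rightarrow> real" where
  "cd_norm \<gamma> k a = (THE r. cd_mult \<gamma> k a (cd_cnj a) = cd_scale r (cd_basis k 0))"

text \<open>
  A zero divisor may be left or right. For the elements \<open>Pr a b\<close> used as vertices the two
  notions agree: these have conjugate \<open>- Pr a b\<close>, so conjugation turns an
  equation $xy = 0$ into $\bar y x = 0$.
\<close>

definition cd_zero_divisor :: "(nat \<Rightarrow> real) \<Rightarrow> nat \<Rightarrow> cd \<Rightarrow> bool" where
  "cd_zero_divisor \<gamma> k x \<longleftrightarrow> x \<in> cd_carrier k \<and> x \<noteq> cd_zero k \<and>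
     (\<exists>y\<in>cd_carrier k. y \<noteq> cd_zero k \<and>
        (cd_mult \<gamma> k x y = cd_zero k \<or> cd_mult \<gamma> k y x = cd_zero k))"

definition cd_orthogonal :: "(nat \<Rightarrow> real) \<Rightarrow> nat \<Rightarrow> cd \<Rightarrow> cd \<Rightarrow> bool" where
  "cd_orthogonal \<gamma> k u v \<longleftrightarrow> cd_mult \<gamma> k u v = cd_zero k \<and> cd_mult \<gamma> k v u = cd_zero k"

definition cd_line :: "cd \<Rightarrow> cd set" where
  "cd_line x = range (\<lambda>r. cd_scale r x)"


section \<open>The graph and its invariants\<close>

text \<open>
  \<open>Gamma_e \<gamma> n\<close> is the graph on the algebra at level \<open>n + 1\<close>. Undirected graphs
  are symmetric digraphs, as in \<open>Graph_Theory\<close>.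
\<close>

definition Gamma_e_verts :: "(nat \<Rightarrow> real) \<Rightarrow> nat \<Rightarrow> cd set set" where
  "Gamma_e_verts \<gamma> n =
     {cd_line (Pr a b) | a b. a \<in> cd_E' n \<and> b \<in> cd_pmE n \<and> cd_zero_divisor \<gamma> (Suc n) (Pr a b)}"

definition Gamma_e :: "(nat \<Rightarrow> real) \<Rightarrow> nat \<Rightarrow> cd set pair_pre_digraph" where
  "Gamma_e \<gamma> n =
     \<lparr> pverts = Gamma_e_verts \<gamma> n,
       parcs = {(L, M). L \<in> Gamma_e_verts \<gamma> n \<and> M \<in> Gamma_e_verts \<gamma> n \<and> L \<noteq> M \<and>
                  (\<exists>u v. L = cd_line u \<and> M = cd_line v \<and> cd_orthogonal \<gamma> (Suc n) u v)} \<rparr>"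

text \<open>
  For a symmetric digraph the strongly connected components are the connected components of the
  undirected graph; \<open>Gamma_e\<close> is symmetric by \<open>Gamma_e_bidirected\<close> below.
\<close>

definition Gamma_e_components :: "(nat \<Rightarrow> real) \<Rightarrow> nat \<Rightarrow> (cd set, cd set \<times> cd set) pre_digraph set"
  where "Gamma_e_components \<gamma> n = pre_digraph.sccs (with_proj (Gamma_e \<gamma> n))"

text \<open>With unit weights, \<open>\<mu>\<close> is the length of a shortest walk (infinite if there is none).\<close>

definition graph_diameter :: "('a, 'b) pre_digraph \<Rightarrow> ereal" where
  "graph_diameter G = (SUP u\<in>verts G. SUP v\<in>verts G. wf_digraph.\<mu> G (\<lambda>_. 1) u v)"

definition vertex_char :: "(nat \<Rightarrow> real) \<Rightarrow> nat \<Rightarrow> cd set \<Rightarrow> real" where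
  "vertex_char \<gamma> n L =
     (THE c. \<exists>a\<in>cd_E' n. \<exists>b\<in>cd_pmE n.
        L = cd_line (Pr a b) \<and> c = \<gamma> n * cd_norm \<gamma> n a / cd_norm \<gamma> n b)"

text \<open>The common value of \<open>vertex_char\<close> on a component.\<close>

definition component_char ::
  "(nat \<Rightarrow> real) \<Rightarrow> nat \<Rightarrow> (cd set, cd set \<times> cd set) pre_digraph \<Rightarrow> real" where
  "component_char \<gamma> n C = the_elem (vertex_char \<gamma> n ` verts C)"


section \<open>Well-definedness\<close>

lemma cd_scale_scale: "cd_scale r (cd_scale s x) = cd_scale (r * s) x"
  by (induction x) auto

lemma cd_cnj_scale: "cd_cnj (cd_scale r x) = cd_scale r (cd_cnj x)"
  by (induction x) (auto simp: cd_scale_scale)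

lemma cd_scale_one: "cd_scale 1 x = x"
  by (induction x) auto

lemma cd_cnj_cnj: "cd_cnj (cd_cnj x) = x"
  by (induction x) (auto simp: cd_cnj_scale cd_scale_scale cd_scale_one)

lemma cd_scale_add_distrib: "cd_scale (r + s) x = cd_add (cd_scale r x) (cd_scale s x)"
  by (induction x) (auto simp: distrib_right)

lemma cd_scale_zero: "cd_scale r (cd_zero k) = cd_zero k"
  by (induction k) auto

lemma cd_scale_closed: "x \<in> cd_carrier k \<Longrightarrow> cd_scale r x \<in> cd_carrier k"
  by (induction k arbitrary: x) auto

lemma cd_cnj_closed: "x \<in> cd_carrier k \<Longrightarrow> cd_cnj x \<in> cd_carrier k"
  by (induction k arbitrary: x) (auto simp: cd_scale_closed)

lemma cd_add_closed: "x \<in> cd_carrier k \<Longrightarrow> y \<in> cd_carrier k \<Longrightarrow> cd_add x y \<in> cd_carrier k"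
  by (induction k arbitrary: x y) auto

lemma cd_mult_closed:
  "x \<in> cd_carrier k \<Longrightarrow> y \<in> cd_carrier k \<Longrightarrow> cd_mult \<gamma> k x y \<in> cd_carrier k"
  by (induction k arbitrary: x y)
     (auto simp: cd_add_closed cd_scale_closed cd_cnj_closed)

lemma cd_scale_add:
  "x \<in> cd_carrier k \<Longrightarrow> y \<in> cd_carrier k \<Longrightarrow>
   cd_scale r (cd_add x y) = cd_add (cd_scale r x) (cd_scale r y)"
  by (induction k arbitrary: x y) (auto simp: distrib_left)

lemma cd_mult_scale:
  assumes "x \<in> cd_carrier k" "y \<in> cd_carrier k"
  shows "cd_mult \<gamma> k (cd_scale r x) y = cd_scale r (cd_mult \<gamma> k x y)"
    and "cd_mult \<gamma> k x (cd_scale r y) = cd_scale r (cd_mult \<gamma> k x y)"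
proof -
  have "cd_mult \<gamma> k (cd_scale r x) y = cd_scale r (cd_mult \<gamma> k x y) \<and>
        cd_mult \<gamma> k x (cd_scale r y) = cd_scale r (cd_mult \<gamma> k x y)"
    using assms
    by (induction k arbitrary: x y)
       (auto simp: cd_cnj_scale cd_scale_scale cd_scale_closed cd_cnj_closed cd_mult_closed
          cd_scale_add[OF cd_mult_closed cd_mult_closed]
          cd_scale_add[OF cd_mult_closed cd_scale_closed[OF cd_mult_closed]] mult.commute)
  then show "cd_mult \<gamma> k (cd_scale r x) y = cd_scale r (cd_mult \<gamma> k x y)"
    and "cd_mult \<gamma> k x (cd_scale r y) = cd_scale r (cd_mult \<gamma> k x y)" by auto
qed

lemma cd_add_uminus: "x \<in> cd_carrier k \<Longrightarrow> cd_add x (cd_uminus x) = cd_zero k"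
  "x \<in> cd_carrier k \<Longrightarrow> cd_add (cd_uminus x) x = cd_zero k"
  by (induction k arbitrary: x) auto

lemma cd_basis_0_scale_inj: "cd_scale r (cd_basis k 0) = cd_scale s (cd_basis k 0) \<Longrightarrow> r = s"
  by (induction k) auto

lemma cd_mult_cnj_real:
  assumes "a \<in> cd_carrier k"
  shows "\<exists>r. cd_mult \<gamma> k a (cd_cnj a) = cd_scale r (cd_basis k 0) \<and>
             cd_mult \<gamma> k (cd_cnj a) a = cd_scale r (cd_basis k 0)"
  using assms
proof (induction k arbitrary: a)
  case 0
  then show ?case by auto
next
  case (Suc k)
  then obtain x y where a: "a = Pr x y" and xy: "x \<in> cd_carrier k" "y \<in> cd_carrier k" by auto
  obtain r s where
    r: "cd_mult \<gamma> k x (cd_cnj x) = cd_scale r (cd_basis k 0)"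
       "cd_mult \<gamma> k (cd_cnj x) x = cd_scale r (cd_basis k 0)" and
    s: "cd_mult \<gamma> k (cd_cnj y) y = cd_scale s (cd_basis k 0)"
    using Suc.IH xy by meson
  have "cd_mult \<gamma> (Suc k) a (cd_cnj a) = cd_scale (r + \<gamma> k * (- s)) (cd_basis (Suc k) 0) \<and>
        cd_mult \<gamma> (Suc k) (cd_cnj a) a = cd_scale (r + \<gamma> k * (- s)) (cd_basis (Suc k) 0)"
    using xy r s
    by (simp add: a cd_cnj_scale cd_cnj_cnj cd_mult_scale cd_cnj_closed cd_scale_scale
        cd_scale_zero cd_add_uminus[OF cd_mult_closed] flip: cd_scale_add_distrib)
  then show ?case by blast
qed

lemma cd_norm_eq:
  assumes "a \<in> cd_carrier k"
  shows "cd_mult \<gamma> k a (cd_cnj a) = cd_scale (cd_norm \<gamma> k a) (cd_basis k 0)"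
    and "cd_mult \<gamma> k (cd_cnj a) a = cd_scale (cd_norm \<gamma> k a) (cd_basis k 0)"
proof -
  obtain r where r: "cd_mult \<gamma> k a (cd_cnj a) = cd_scale r (cd_basis k 0)"
       "cd_mult \<gamma> k (cd_cnj a) a = cd_scale r (cd_basis k 0)"
    using cd_mult_cnj_real[OF assms] by blast
  then have "cd_norm \<gamma> k a = r"
    unfolding cd_norm_def by (auto dest: cd_basis_0_scale_inj)
  with r show "cd_mult \<gamma> k a (cd_cnj a) = cd_scale (cd_norm \<gamma> k a) (cd_basis k 0)"
    and "cd_mult \<gamma> k (cd_cnj a) a = cd_scale (cd_norm \<gamma> k a) (cd_basis k 0)" by auto
qed

lemma Gamma_e_bidirected: "pair_bidirected_digraph (Gamma_e \<gamma> n)"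
  by unfold_locales (auto simp: Gamma_e_def symmetric_def sym_def cd_orthogonal_def)

end

theory Submission
  imports Defs
begin

text \<open>
  Basis products are $e_i e_j = \pm e_{i \oplus j}$ with $\oplus$ the bitwise exclusive or. Orthogonality
  of $(e_i, s e_{i \oplus m})$ and $(e_k, t e_{k \oplus m'})$ forces $m = m'$, so the candidates for the
  components are the classes of lines with the same $m$, on which the characteristic is
  $\chi = \gamma_n n(e_m)$. Within a class orthogonality means that an indicator depending only on $i, k$
  equals 1 and that $s t$ equals a sign depending only on $i, k$: the class is a double cover of a
  signed graph on the indices. If $i$ and $k$ are adjacent then so are both to $i \oplus k$, and this
  triangle has negative sign. Any two indices $i, k$ have a common neighbour $q \neq k$, hence the walks
  through $q$ and through $q, q \oplus k$ have opposite signs, and any two lines of a class are joined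
  by a walk of length at most 3. For $\chi = 1$ the index $m$ is adjacent to every other one; for
  $\chi = -1$ the common neighbour is found with the top index $2^{n-1}$, whose products are explicit.
\<close>

unbundle bit_operations_syntax

section \<open>Exclusive or on basis indices\<close>

lemma xor_cancel_left [simp]: "a XOR (a XOR b) = b" for a b :: nat
  by (simp flip: xor.assoc)

lemma xor_cancel_right [simp]: "(b XOR a) XOR a = b" for a b :: nat
  by (simp add: xor.assoc)

lemma xor_cancel_mid [simp]: "a XOR (b XOR a) = b" "(a XOR b) XOR a = b" for a b :: nat
  by (simp_all add: ac_simps)

lemma xor_left_inject [simp]: "a XOR b = a XOR c \<longleftrightarrow> b = c" for a b c :: nat
proof
  assume "a XOR b = a XOR c"
  then have "a XOR (a XOR b) = a XOR (a XOR c)" by (rule arg_cong)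
  then show "b = c" by simp
qed simp

lemma xor_right_inject [simp]: "b XOR a = c XOR a \<longleftrightarrow> b = c" for a b c :: nat
  by (simp add: xor.commute[of _ a])

lemma xor_eq_0_iff [simp]: "a XOR b = 0 \<longleftrightarrow> a = b" for a b :: nat
  using xor_left_inject[of a b a] by (auto simp del: xor_left_inject)

lemma xor_pos_iff [simp]: "0 < a XOR b \<longleftrightarrow> a \<noteq> b" for a b :: nat
  by (simp flip: neq0_conv)

lemma xor_eq_self_iff [simp]:
  "a XOR b = a \<longleftrightarrow> b = 0" "b XOR a = a \<longleftrightarrow> b = 0" for a b :: nat
  using xor_left_inject[of a b 0] xor_right_inject[of b a 0] by (simp_all del: xor_left_inject xor_right_inject)

lemma xor_less_power2:
  fixes a b :: nat
  assumes "a < 2 ^ k" "b < 2 ^ k"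
  shows "a XOR b < 2 ^ k"
  using assms by (simp flip: take_bit_nat_eq_self_iff)

text \<open>Bit \<open>k\<close> of \<open>a\<close> is unset, so no carry occurs. The shift by
  \<open>2 ^ k\<close> in \<open>cd_basis\<close> thus becomes an exclusive or, and index
  computations reduce to the laws of \<open>XOR\<close>.\<close>

lemma power2_add_eq_xor: "2 ^ k + a = 2 ^ k XOR a" if "a < 2 ^ k" for a :: nat
proof (rule disjunctive_add_eq_xor, rule bit_eqI)
  show "bit (2 ^ k AND a) i \<longleftrightarrow> bit 0 i" for i
    using that bit_take_bit_iff[of k a i] take_bit_nat_eq_self[OF that]
    by (auto simp: bit_simps)
qed

lemma power2_le_xor: "a < 2 ^ k \<Longrightarrow> 2 ^ k \<le> 2 ^ k XOR a" for a :: nat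
  by (simp flip: power2_add_eq_xor)

text \<open>The cases are the two summands of a doubling; inductions on the level split indices this
  way.\<close>

lemma less_power2_SucE:
  fixes a :: nat
  assumes "a < 2 ^ Suc k"
  obtains "a < 2 ^ k" | b where "b < 2 ^ k" "a = 2 ^ k XOR b"
proof (cases "a < 2 ^ k")
  case False
  then have "a - 2 ^ k < 2 ^ k" "2 ^ k + (a - 2 ^ k) = a" using assms by auto
  then show thesis using that(2)[of "a - 2 ^ k"] power2_add_eq_xor[of "a - 2 ^ k" k] by simp
qed (rule that)

section \<open>Products of basis elements\<close>

text \<open>The eigenvalue of conjugation at $e_j$: basis elements other than the unit are
  imaginary.\<close>

definition cnj_sign :: "nat \<Rightarrow> real" where
  "cnj_sign j = (if j = 0 then 1 else - 1)"

lemma cnj_sign_square: "cnj_sign j * cnj_sign j = 1" "cnj_sign j * (cnj_sign j * x) = x"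
  by (auto simp: cnj_sign_def)

text \<open>The structure constants of the standard basis. The four cases are the products
  $(a,0)(c,0)$, $(a,0)(0,d)$, $(0,b)(c,0)$ and $(0,b)(0,d)$, with conjugates replaced by
  \<open>cnj_sign\<close>.\<close>

primrec cd_sign :: "(nat \<Rightarrow> real) \<Rightarrow> nat \<Rightarrow> nat \<Rightarrow> nat \<Rightarrow> real" where
  "cd_sign \<gamma> 0 i j = 1"
| "cd_sign \<gamma> (Suc k) i j =
     (if i < 2 ^ k then
        if j < 2 ^ k then cd_sign \<gamma> k i j else cd_sign \<gamma> k (j - 2 ^ k) i
      else if j < 2 ^ k then cnj_sign j * cd_sign \<gamma> k (i - 2 ^ k) j
      else \<gamma> k * cnj_sign (j - 2 ^ k) * cd_sign \<gamma> k (j - 2 ^ k) (i - 2 ^ k))"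

lemma cd_sign_Suc:
  assumes "i < 2 ^ k" "j < 2 ^ k"
  shows "cd_sign \<gamma> (Suc k) i j = cd_sign \<gamma> k i j"
    and "cd_sign \<gamma> (Suc k) i (2 ^ k XOR j) = cd_sign \<gamma> k j i"
    and "cd_sign \<gamma> (Suc k) (2 ^ k XOR i) j = cnj_sign j * cd_sign \<gamma> k i j"
    and "cd_sign \<gamma> (Suc k) (2 ^ k XOR i) (2 ^ k XOR j) = \<gamma> k * cnj_sign j * cd_sign \<gamma> k j i"
  using assms by (simp_all flip: power2_add_eq_xor)

lemma cd_zero_closed: "cd_zero k \<in> cd_carrier k"
  by (induction k) auto

lemma cd_basis_closed: "cd_basis k j \<in> cd_carrier k"
  by (induction k arbitrary: j) (auto simp: cd_zero_closed)

lemma cd_basis_Suc: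
  assumes "j < 2 ^ k"
  shows "cd_basis (Suc k) j = Pr (cd_basis k j) (cd_zero k)"
    and "cd_basis (Suc k) (2 ^ k XOR j) = Pr (cd_zero k) (cd_basis k j)"
  using assms by (simp_all flip: power2_add_eq_xor)

lemma cd_scale_0: "x \<in> cd_carrier k \<Longrightarrow> cd_scale 0 x = cd_zero k"
  by (induction k arbitrary: x) auto

lemma cd_add_zero:
  assumes "x \<in> cd_carrier k"
  shows "cd_add x (cd_zero k) = x" "cd_add (cd_zero k) x = x"
  using assms by (induction k arbitrary: x) auto

lemma cd_cnj_zero: "cd_cnj (cd_zero k) = cd_zero k"
  by (induction k) (auto simp: cd_scale_zero)

text \<open>Zero is its own multiple by \<open>0\<close>, so homogeneity in each factor suffices,
  without induction.\<close>

lemma cd_mult_zero: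
  assumes "x \<in> cd_carrier k"
  shows "cd_mult \<gamma> k x (cd_zero k) = cd_zero k" "cd_mult \<gamma> k (cd_zero k) x = cd_zero k"
  using cd_mult_scale(2)[OF assms cd_zero_closed, of \<gamma> 0]
    cd_mult_scale(1)[OF cd_zero_closed assms, of \<gamma> 0]
  by (simp_all add: cd_scale_zero cd_scale_0[OF cd_mult_closed[OF assms cd_zero_closed]]
      cd_scale_0[OF cd_mult_closed[OF cd_zero_closed assms]])

lemma cd_cnj_basis: "cd_cnj (cd_basis k j) = cd_scale (cnj_sign j) (cd_basis k j)"
  if "j < 2 ^ k"
  using that
proof (induction k arbitrary: j)
  case (Suc k)
  from Suc.prems show ?case
    by (rule less_power2_SucE)
      (auto simp: cd_basis_Suc Suc.IH cd_scale_zero cd_cnj_zero cnj_sign_def cd_scale_one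
       dest: power2_le_xor)
qed (auto simp: cnj_sign_def)

lemmas cd_closed = cd_zero_closed cd_basis_closed cd_add_closed cd_scale_closed cd_cnj_closed
  cd_mult_closed

lemma cd_basis_mult:
  assumes "i < 2 ^ k" "j < 2 ^ k"
  shows "cd_mult \<gamma> k (cd_basis k i) (cd_basis k j) = cd_scale (cd_sign \<gamma> k i j) (cd_basis k (i XOR j))"
  using assms
proof (induction k arbitrary: i j)
  case (Suc k)
  from Suc.prems(1) show ?case
  proof (cases rule: less_power2_SucE)
    case i: 1
    from Suc.prems(2) show ?thesis
    proof (cases rule: less_power2_SucE)
      case j: 1
      show ?thesis
        using i j by (simp add: cd_basis_Suc cd_sign_Suc Suc.IH xor_less_power2 cd_mult_zero cd_cnj_zero
          cd_scale_zero cd_add_zero cd_closed del: cd_basis.simps cd_sign.simps)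
    next
      case j: (2 j')
      have "i XOR (2 ^ k XOR j') = 2 ^ k XOR (j' XOR i)" by (simp add: ac_simps)
      then show ?thesis
        using i j by (simp add: cd_basis_Suc cd_sign_Suc Suc.IH xor_less_power2 cd_mult_zero cd_cnj_zero
          cd_scale_zero cd_add_zero cd_closed cd_mult_scale cd_cnj_basis del: cd_basis.simps cd_sign.simps)
    qed
  next
    case i: (2 i')
    from Suc.prems(2) show ?thesis
    proof (cases rule: less_power2_SucE)
      case j: 1
      have "(2 ^ k XOR i') XOR j = 2 ^ k XOR (i' XOR j)" by (simp add: ac_simps)
      then show ?thesis
        using i j by (simp add: cd_basis_Suc cd_sign_Suc Suc.IH xor_less_power2 cd_mult_zero cd_cnj_zero
          cd_scale_zero cd_add_zero cd_closed cd_mult_scale cd_cnj_basis cd_scale_scale del: cd_basis.simps cd_sign.simps)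
    next
      case j: (2 j')
      have "(2 ^ k XOR i') XOR (2 ^ k XOR j') = j' XOR i'"
        by (metis xor.assoc xor.commute xor_cancel_left)
      then show ?thesis
        using i j by (simp add: cd_basis_Suc cd_sign_Suc Suc.IH xor_less_power2 cd_mult_zero cd_cnj_zero
          cd_scale_zero cd_add_zero cd_closed cd_mult_scale cd_cnj_basis cd_scale_scale mult.assoc
          del: cd_basis.simps cd_sign.simps)
    qed
  qed
qed simp

section \<open>Conjugation of products; alternativity and flexibility of basis elements\<close>

lemma cd_add_commute: "x \<in> cd_carrier k \<Longrightarrow> y \<in> cd_carrier k \<Longrightarrow> cd_add x y = cd_add y x"
  by (induction k arbitrary: x y) auto

lemma cd_cnj_add:
  "x \<in> cd_carrier k \<Longrightarrow> y \<in> cd_carrier k \<Longrightarrow> cd_cnj (cd_add x y) = cd_add (cd_cnj x) (cd_cnj y)"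
  by (induction k arbitrary: x y) (auto simp: cd_scale_add)

lemma cd_cnj_mult:
  assumes "x \<in> cd_carrier k" "y \<in> cd_carrier k"
  shows "cd_cnj (cd_mult \<gamma> k x y) = cd_mult \<gamma> k (cd_cnj y) (cd_cnj x)"
  using assms
proof (induction k arbitrary: x y)
  case (Suc k)
  then obtain a b c d where xy: "x = Pr a b" "y = Pr c d"
    and [simp]: "a \<in> cd_carrier k" "b \<in> cd_carrier k" "c \<in> cd_carrier k" "d \<in> cd_carrier k" by auto
  have "cd_add (cd_mult \<gamma> k d a) (cd_mult \<gamma> k b (cd_cnj c)) =
        cd_add (cd_mult \<gamma> k b (cd_cnj c)) (cd_mult \<gamma> k d a)"
    by (rule cd_add_commute[of _ k]) (simp_all add: cd_closed)
  with xy show ?case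
    by (simp add: cd_cnj_add[of _ k] cd_closed Suc.IH cd_cnj_scale cd_cnj_cnj cd_mult_scale
        cd_scale_scale cd_scale_one cd_scale_add[of _ k])
qed (auto simp: mult.commute)

text \<open>Algebras of high level are not alternative, but basis elements still alternate with
  every element. Multiplying twice by $(a,0)$ or $(0,b)$ leads to left as well as right double
  products one level down, so both laws are proved in one induction.\<close>

lemma cd_basis_alternative:
  assumes "i < 2 ^ k" "x \<in> cd_carrier k"
  defines "e \<equiv> cd_basis k i"
  shows "cd_mult \<gamma> k e (cd_mult \<gamma> k e x) = cd_scale (cd_sign \<gamma> k i i) x \<and>
         cd_mult \<gamma> k (cd_mult \<gamma> k x e) e = cd_scale (cd_sign \<gamma> k i i) x"
  using assms(1,2) unfolding e_def
proof (induction k arbitrary: i x)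
  case (Suc k)
  from Suc.prems(2) obtain c d where x: "x = Pr c d"
    and [simp]: "c \<in> cd_carrier k" "d \<in> cd_carrier k" by auto
  from Suc.prems(1) show ?case
  proof (cases rule: less_power2_SucE)
    case 1
    then show ?thesis
      by (simp add: x cd_basis_Suc cd_sign_Suc Suc.IH cd_mult_zero cd_cnj_zero cd_cnj_basis
          cd_scale_zero cd_add_zero cd_mult_scale cd_closed cd_scale_scale cnj_sign_def cd_scale_one
          del: cd_basis.simps cd_sign.simps)
  next
    case (2 j)
    then show ?thesis
      by (simp add: x cd_basis_Suc cd_sign_Suc Suc.IH cd_mult_zero cd_cnj_zero cd_cnj_basis
          cd_cnj_mult cd_cnj_scale cd_cnj_cnj
          cd_scale_zero cd_add_zero cd_mult_scale cd_closed cd_scale_scale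
          del: cd_basis.simps cd_sign.simps) (simp add: ac_simps)
  qed
qed auto

text \<open>For $(a,0)$ the first component is the same law one level down, and in the second only a
  conjugation sign moves. For $(0,b)$ the law reduces to alternativity.\<close>

lemma cd_basis_flexible:
  assumes "i < 2 ^ k" "x \<in> cd_carrier k"
  defines "e \<equiv> cd_basis k i"
  shows "cd_mult \<gamma> k e (cd_mult \<gamma> k x e) = cd_mult \<gamma> k (cd_mult \<gamma> k e x) e"
  using assms(1,2) unfolding e_def
proof (induction k arbitrary: i x)
  case (Suc k)
  from Suc.prems(2) obtain c d where x: "x = Pr c d"
    and [simp]: "c \<in> cd_carrier k" "d \<in> cd_carrier k" by auto
  from Suc.prems(1) show ?case
  proof (cases rule: less_power2_SucE)
    case 1
    then show ?thesis
      by (simp add: x cd_basis_Suc cd_sign_Suc Suc.IH cd_mult_zero cd_cnj_zero cd_cnj_basis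
          cd_scale_zero cd_add_zero cd_mult_scale cd_closed cd_scale_scale cnj_sign_def cd_scale_one
          del: cd_basis.simps cd_sign.simps)
  next
    case (2 j)
    then show ?thesis
      by (simp add: x cd_basis_Suc cd_sign_Suc Suc.IH cd_mult_zero cd_cnj_zero cd_cnj_basis
          cd_cnj_mult cd_cnj_scale cd_cnj_cnj cd_basis_alternative
          cd_scale_zero cd_add_zero cd_mult_scale cd_closed cd_scale_scale cnj_sign_square mult.assoc
          del: cd_basis.simps cd_sign.simps)
  qed
qed auto

section \<open>Linear independence of basis elements\<close>

lemma cd_scale_eq_zero_iff: "cd_scale r (cd_basis k j) = cd_zero k \<longleftrightarrow> r = 0" if "j < 2 ^ k"
  using that
proof (induction k arbitrary: j)
  case (Suc k)
  from Suc.prems show ?case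
    by (rule less_power2_SucE)
      (auto simp: cd_basis_Suc Suc.IH cd_scale_zero simp del: cd_basis.simps)
qed simp

lemma cd_scale_basis_eq_iff:
  assumes "i < 2 ^ k" "j < 2 ^ k"
  shows "cd_scale r (cd_basis k i) = cd_scale s (cd_basis k j) \<longleftrightarrow> r = s \<and> (r = 0 \<or> i = j)"
  using assms
proof (induction k arbitrary: i j)
  case (Suc k)
  have z: "cd_zero k = cd_scale r (cd_basis k j) \<longleftrightarrow> r = 0" if "j < 2 ^ k" for r j
    using cd_scale_eq_zero_iff[OF that] by metis
  from Suc.prems(1) show ?case
  proof (cases rule: less_power2_SucE)
    case i: 1
    from Suc.prems(2) show ?thesis
      using i by (cases rule: less_power2_SucE)
        (auto simp: cd_basis_Suc Suc.IH cd_scale_zero cd_scale_eq_zero_iff z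
          simp del: cd_basis.simps dest: power2_le_xor)
  next
    case i: (2 i')
    from Suc.prems(2) show ?thesis
      using i by (cases rule: less_power2_SucE)
        (auto simp: cd_basis_Suc Suc.IH cd_scale_zero cd_scale_eq_zero_iff z
          simp del: cd_basis.simps dest: power2_le_xor)
  qed
qed simp

lemma cd_add_eq_zero_iff:
  assumes "x \<in> cd_carrier k" "y \<in> cd_carrier k"
  shows "cd_add x y = cd_zero k \<longleftrightarrow> y = cd_uminus x"
  using assms by (induction k arbitrary: x y) auto

lemma cd_add_scale_basis_eq_zero_iff:
  assumes "i < 2 ^ k" "j < 2 ^ k"
  shows "cd_add (cd_scale r (cd_basis k i)) (cd_scale s (cd_basis k j)) = cd_zero k \<longleftrightarrow>
    r + s = 0 \<and> (r = 0 \<or> i = j)"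
  using assms by (auto simp: cd_add_eq_zero_iff[of _ k] cd_closed cd_scale_scale cd_scale_basis_eq_iff)

text \<open>The norm of $e_i$ and $-e_i$, read off from $e_i$ times its conjugate; see
  \<open>cd_norm_basis\<close>.\<close>

definition basis_norm :: "(nat \<Rightarrow> real) \<Rightarrow> nat \<Rightarrow> nat \<Rightarrow> real" where
  "basis_norm \<gamma> n i = cnj_sign i * cd_sign \<gamma> n i i"

section \<open>Relations between the signs of basis products\<close>

context
  fixes \<gamma> :: "nat \<Rightarrow> real" and n :: nat
  assumes \<gamma>: "\<forall>k<n. \<gamma> k \<in> {1, - 1}"
begin

lemma cd_sign_cases: "i < 2 ^ n \<Longrightarrow> j < 2 ^ n \<Longrightarrow> cd_sign \<gamma> n i j \<in> {1, - 1}"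
  using \<gamma>
proof (induction n arbitrary: i j)
  case (Suc k)
  have s: "cnj_sign j \<in> {1, - 1}" "\<gamma> k \<in> {1, -1}" for j
    using Suc.prems by (auto simp: cnj_sign_def)
  have IH: "cd_sign \<gamma> k i j \<in> {1, - 1}" if "i < 2 ^ k" "j < 2 ^ k" for i j
    using that Suc.prems(3) by (intro Suc.IH) auto
  have p: "x * y \<in> {1, -1}" if "x \<in> {1, -1}" "y \<in> {1, -1}" for x y :: real
    using that by auto
  from Suc.prems(1) show ?case
  proof (cases rule: less_power2_SucE)
    case i: 1
    from Suc.prems(2) show ?thesis
      using i by (cases rule: less_power2_SucE) (simp_all only: cd_sign_Suc IH)
  next
    case i: (2 i')
    from Suc.prems(2) show ?thesis
      using i by (cases rule: less_power2_SucE)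
        (simp_all only: cd_sign_Suc IH s p)
  qed
qed simp

lemma cd_sign_square:
  assumes "i < 2 ^ n" "j < 2 ^ n"
  shows "cd_sign \<gamma> n i j * cd_sign \<gamma> n i j = 1"
  using cd_sign_cases[OF assms] by auto

text \<open>Conjugation reverses the product $e_i e_j$; both sides are compared by
  coefficient.\<close>

lemma cd_sign_swap:
  assumes "i < 2 ^ n" "j < 2 ^ n"
  shows "cd_sign \<gamma> n j i = cnj_sign i * cnj_sign j * cnj_sign (i XOR j) * cd_sign \<gamma> n i j"
proof -
  have "cd_cnj (cd_mult \<gamma> n (cd_basis n i) (cd_basis n j)) =
        cd_mult \<gamma> n (cd_cnj (cd_basis n j)) (cd_cnj (cd_basis n i))"
    by (simp add: cd_cnj_mult cd_closed)
  then have "cd_sign \<gamma> n i j * cnj_sign (i XOR j) = cnj_sign j * (cnj_sign i * cd_sign \<gamma> n j i)"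
    using assms xor_less_power2[OF assms]
    by (simp add: cd_basis_mult cd_cnj_scale cd_cnj_basis cd_scale_scale cd_mult_scale cd_closed
        xor.commute[of j] cd_scale_basis_eq_iff cd_sign_square)
  then show ?thesis
    by (auto simp: cnj_sign_def split: if_splits)
qed

text \<open>Coefficients of the left alternative law $e_i (e_i e_j) = (e_i e_i) e_j$;
  \<open>cd_sign_right_xor\<close> is its mirror image.\<close>

lemma cd_sign_left_xor:
  assumes "i < 2 ^ n" "j < 2 ^ n"
  shows "cd_sign \<gamma> n i (i XOR j) = cd_sign \<gamma> n i i * cd_sign \<gamma> n i j"
proof -
  have "cd_sign \<gamma> n i j * cd_sign \<gamma> n i (i XOR j) = cd_sign \<gamma> n i i"
    using cd_basis_alternative[OF assms(1) cd_basis_closed, of \<gamma> j] assms xor_less_power2[OF assms]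
    by (simp add: cd_basis_mult cd_mult_scale cd_closed cd_scale_scale cd_scale_basis_eq_iff)
  then show ?thesis
    using cd_sign_cases[OF assms] by auto
qed

lemma cd_sign_right_xor:
  assumes "i < 2 ^ n" "j < 2 ^ n"
  shows "cd_sign \<gamma> n (i XOR j) j = cd_sign \<gamma> n j j * cd_sign \<gamma> n i j"
proof -
  have "cd_sign \<gamma> n i j * cd_sign \<gamma> n (i XOR j) j = cd_sign \<gamma> n j j"
    using cd_basis_alternative[OF assms(2) cd_basis_closed, of \<gamma> i] assms xor_less_power2[OF assms]
    by (simp add: cd_basis_mult cd_mult_scale cd_closed cd_scale_scale cd_scale_basis_eq_iff)
  then show ?thesis
    using cd_sign_cases[OF assms] by auto
qed

lemma cd_sign_0:
  assumes "i < 2 ^ n"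
  shows "cd_sign \<gamma> n 0 i = 1" "cd_sign \<gamma> n i 0 = 1"
proof -
  have "cd_sign \<gamma> n 0 0 = 1"
    by (induction n) auto
  then show *: "cd_sign \<gamma> n 0 i = 1"
    using cd_sign_left_xor[of i i] cd_sign_right_xor[of 0 i] cd_sign_cases[OF assms assms] assms
    by auto
  then show "cd_sign \<gamma> n i 0 = 1"
    using cd_sign_swap[of 0 i] assms by (simp add: cnj_sign_def)
qed

lemma basis_norm_cases: "i < 2 ^ n \<Longrightarrow> basis_norm \<gamma> n i \<in> {1, - 1}"
  using cd_sign_cases[of i i] by (auto simp: basis_norm_def cnj_sign_def)

text \<open>The norm is not multiplicative in high levels, but it is on basis elements:
  alternativity expresses the square of $e_x$, \<open>x = i XOR j\<close>, by the squares of $e_i$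
  and $e_j$ and the product of \<open>cd_sign \<gamma> n i j\<close> and
  \<open>cd_sign \<gamma> n j i\<close>, which \<open>cd_sign_swap\<close> evaluates.\<close>

lemma basis_norm_xor:
  assumes "i < 2 ^ n" "j < 2 ^ n"
  shows "basis_norm \<gamma> n (i XOR j) = basis_norm \<gamma> n i * basis_norm \<gamma> n j"
proof -
  let ?\<sigma> = "cd_sign \<gamma> n" and ?x = "i XOR j"
  have x: "?x < 2 ^ n" by (rule xor_less_power2[OF assms])
  have "?\<sigma> ?x i = ?\<sigma> i i * ?\<sigma> j i" using cd_sign_right_xor[OF assms(2,1)] by (simp add: xor.commute)
  moreover have "?\<sigma> ?x j = ?\<sigma> j j * ?\<sigma> i j" using cd_sign_right_xor[OF assms] by simp
  \<comment> \<open>The left law at \<open>?x\<close>, because \<open>?x XOR j\<close> is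
    \<open>i\<close>.\<close>
  moreover have "?\<sigma> ?x i = ?\<sigma> ?x ?x * ?\<sigma> ?x j"
    using cd_sign_left_xor[OF x assms(2)] by simp
  ultimately have "?\<sigma> ?x ?x = ?\<sigma> i i * ?\<sigma> j j * (?\<sigma> i j * ?\<sigma> j i)"
    using cd_sign_cases[OF assms] cd_sign_cases[OF assms(2) assms(2)] by auto
  also have "?\<sigma> i j * ?\<sigma> j i = cnj_sign i * cnj_sign j * cnj_sign ?x"
    using cd_sign_swap[OF assms] cd_sign_cases[OF assms] by auto
  finally show ?thesis
    by (auto simp: basis_norm_def cnj_sign_def)
qed

end

section \<open>The signed graph on the indices\<close>

locale cd_graph =
  fixes \<gamma> :: "nat \<Rightarrow> real" and n :: nat
  assumes n: "n \<ge> 3" and \<gamma>: "\<forall>k\<le>n. \<gamma> k \<in> {1, - 1}"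
begin

text \<open>The second form serves level \<open>n - 1\<close>, to which products with the top index
  are reduced.\<close>

lemma \<gamma>_less: "\<forall>k<n. \<gamma> k \<in> {1, - 1}" and \<gamma>_less': "\<forall>k<n - 1. \<gamma> k \<in> {1, - 1}"
  using \<gamma> by auto

abbreviation \<sigma> :: "nat \<Rightarrow> nat \<Rightarrow> real" where "\<sigma> \<equiv> cd_sign \<gamma> n"

lemmas \<sigma>_cases = cd_sign_cases[OF \<gamma>_less]
  and \<sigma>_square = cd_sign_square[OF \<gamma>_less]
  and \<sigma>_swap = cd_sign_swap[OF \<gamma>_less]
  and \<sigma>_left_xor = cd_sign_left_xor[OF \<gamma>_less]
  and \<sigma>_right_xor = cd_sign_right_xor[OF \<gamma>_less]
  and \<sigma>_0 = cd_sign_0[OF \<gamma>_less]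

lemma \<sigma>_square_left: "i < 2 ^ n \<Longrightarrow> j < 2 ^ n \<Longrightarrow> \<sigma> i j * (\<sigma> i j * x) = x"
  using \<sigma>_cases[of i j] by auto

text \<open>The characteristic of every line through $(e_i, s e_j)$ with \<open>i XOR j = m\<close>:
  norms of basis elements are signs and multiplicative, so their quotient is the norm of
  $e_m$.\<close>

definition chi :: "nat \<Rightarrow> real" where
  "chi m = \<gamma> n * basis_norm \<gamma> n m"

lemma chi_cases: "m < 2 ^ n \<Longrightarrow> chi m \<in> {1, - 1}"
  using basis_norm_cases[OF \<gamma>_less, of m] \<gamma> by (auto simp: chi_def)

text \<open>
  The lines through \<open>Pr e\<^sub>i (s e\<^sub>j)\<close> and \<open>Pr e\<^sub>k (t e\<^sub>l)\<close>, where \<open>i XOR j = k XOR l = m\<close>, will turn out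
  to be orthogonal iff \<open>edge_ind m i k = 1\<close> and \<open>s * t = edge_sign m i k\<close>.
\<close>

definition edge_sign :: "nat \<Rightarrow> nat \<Rightarrow> nat \<Rightarrow> real" where
  "edge_sign m i k = \<sigma> (k XOR m) i * \<sigma> (i XOR m) k"

definition edge_ind :: "nat \<Rightarrow> nat \<Rightarrow> nat \<Rightarrow> real" where
  "edge_ind m i k =
     - \<gamma> n * cnj_sign (k XOR m) * \<sigma> (k XOR m) (i XOR m) * \<sigma> i k * edge_sign m i k"

section \<open>Symmetries of edge signs and edge indicators\<close>

lemma edge_sign_commute: "edge_sign m i k = edge_sign m k i"
  by (simp add: edge_sign_def)

lemma edge_sign_cases:
  assumes "m < 2 ^ n" "i < 2 ^ n" "k < 2 ^ n"
  shows "edge_sign m i k \<in> {1, - 1}"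
  using assms \<sigma>_cases[of "k XOR m" i] \<sigma>_cases[of "i XOR m" k]
  by (auto simp: edge_sign_def xor_less_power2)

lemma edge_sign_self: "m < 2 ^ n \<Longrightarrow> i < 2 ^ n \<Longrightarrow> edge_sign m i i = 1"
  by (simp add: edge_sign_def \<sigma>_square xor_less_power2)

text \<open>Right alternativity pairs off the six factors up to the squares of $e_i$, $e_k$ and
  $e_p$, \<open>p = i XOR k\<close>. The norm of an imaginary basis element is minus its square, so
  by multiplicativity of norms these three squares multiply to $-1$.\<close>

lemma edge_sign_triangle:
  assumes "m < 2 ^ n" "i < 2 ^ n" "k < 2 ^ n" "i \<noteq> 0" "k \<noteq> 0" "i \<noteq> k"
  shows "edge_sign m i k * edge_sign m k (i XOR k) * edge_sign m (i XOR k) i = - 1"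
proof -
  define p q where "p = i XOR k" and "q = p XOR m"
  note lt = xor_less_power2[of _ n]
  have "\<sigma> q i = \<sigma> i i * \<sigma> (k XOR m) i"
    using \<sigma>_right_xor[of "k XOR m" i] assms by (simp add: lt p_def q_def ac_simps)
  moreover have "\<sigma> q k = \<sigma> k k * \<sigma> (i XOR m) k"
    using \<sigma>_right_xor[of "i XOR m" k] assms by (simp add: lt p_def q_def ac_simps)
  moreover have "\<sigma> (i XOR m) p = \<sigma> p p * \<sigma> (k XOR m) p"
    using \<sigma>_right_xor[of "k XOR m" p] assms by (simp add: lt p_def q_def ac_simps)
  moreover have "\<sigma> i i * \<sigma> k k * \<sigma> p p = - 1"
    using basis_norm_xor[OF \<gamma>_less, of i k] assms \<sigma>_cases[of i i] \<sigma>_cases[of k k]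
    by (auto simp: basis_norm_def cnj_sign_def p_def)
  ultimately show ?thesis
    using assms by (simp add: edge_sign_def p_def[symmetric] q_def[symmetric])
      (simp add: \<sigma>_square \<sigma>_square_left lt p_def ac_simps)
qed

text \<open>\<open>\<sigma>_swap\<close> is applied to \<open>i\<close>, \<open>k\<close> and to
  their partners \<open>i XOR m\<close>, \<open>k XOR m\<close>. Both pairs have the same exclusive
  or, so the two conjugation signs attached to it cancel.\<close>

lemma edge_ind_commute:
  assumes "m < 2 ^ n" "i < 2 ^ n" "k < 2 ^ n" "i \<noteq> 0" "k \<noteq> 0"
  shows "edge_ind m i k = edge_ind m k i"
  using assms \<sigma>_swap[of i k] \<sigma>_swap[of "k XOR m" "i XOR m"]
  by (auto simp: edge_ind_def edge_sign_commute[of m i] xor_less_power2 cnj_sign_def ac_simps)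

text \<open>
  Up to the characteristic, the indicator of an edge is the sign relating $(e_j e_k) e_i$ and
  $e_j (e_k e_i)$.
\<close>

lemma edge_ind_associator:
  assumes "m < 2 ^ n" "i < 2 ^ n" "k < 2 ^ n" "i \<noteq> 0" "k \<noteq> 0"
  defines "j \<equiv> i XOR m"
  shows "edge_ind m i k = chi m * \<sigma> j k * \<sigma> (j XOR k) i * \<sigma> k i * \<sigma> j (k XOR i)"
proof -
  define l where "l = k XOR m"
  have j: "j < 2 ^ n" and l: "l < 2 ^ n" using assms by (simp_all add: l_def xor_less_power2)
  have eqs: "j XOR k = l XOR i" "k XOR i = j XOR l" "m = i XOR j" "l XOR j = i XOR k"
    by (simp_all add: l_def j_def ac_simps)
  have "\<sigma> (j XOR k) i = \<sigma> i i * \<sigma> l i"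
    using \<sigma>_right_xor[OF l assms(2)] by (simp add: eqs)
  moreover have "\<sigma> j (k XOR i) = \<sigma> j j * \<sigma> j l"
    using \<sigma>_left_xor[OF j l] by (simp add: eqs)
  moreover have "chi m = \<gamma> n * (cnj_sign i * \<sigma> i i) * (cnj_sign j * \<sigma> j j)"
    using basis_norm_xor[OF \<gamma>_less assms(2) j] by (simp add: chi_def basis_norm_def eqs)
  moreover have "\<sigma> k i = cnj_sign i * cnj_sign k * cnj_sign (i XOR k) * \<sigma> i k"
    by (rule \<sigma>_swap) fact+
  moreover have "\<sigma> j l = cnj_sign l * cnj_sign j * cnj_sign (i XOR k) * \<sigma> l j"
    using \<sigma>_swap[OF l j] by (simp add: eqs)
  ultimately show ?thesis
    using assms(1-5) j l
    by (simp add: edge_ind_def edge_sign_def j_def[symmetric] l_def[symmetric])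
      (auto simp: \<sigma>_square \<sigma>_square_left cnj_sign_def ac_simps)
qed

text \<open>In the form of \<open>edge_ind_associator\<close>, passing from \<open>k\<close> to
  \<open>i XOR k\<close> exchanges two factors, while each of the other two gains
  \<open>\<sigma> i i\<close>.\<close>

lemma edge_ind_xor:
  assumes "m < 2 ^ n" "i < 2 ^ n" "k < 2 ^ n" "i \<noteq> 0" "k \<noteq> 0" "i \<noteq> k"
  shows "edge_ind m i (i XOR k) = edge_ind m i k"
proof -
  define j where "j = i XOR m"
  have j: "j < 2 ^ n" using assms by (simp add: j_def xor_less_power2)
  have "\<sigma> (i XOR k) i = \<sigma> i i * \<sigma> k i"
    using \<sigma>_right_xor[of k i] assms by (simp add: ac_simps)
  moreover have "\<sigma> (j XOR (i XOR k)) i = \<sigma> i i * \<sigma> (j XOR k) i"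
    using \<sigma>_right_xor[of "j XOR k" i] assms j by (simp add: ac_simps xor_less_power2)
  ultimately show ?thesis
    using assms j
    by (simp add: edge_ind_associator j_def[symmetric] xor_less_power2)
      (simp add: \<sigma>_square_left ac_simps)
qed

text \<open>Replacing \<open>k\<close> by its partner transposes all four signs in
  \<open>edge_ind\<close>, and the conjugation signs from \<open>\<sigma>_swap\<close> cancel in
  pairs. The partner is imaginary because \<open>k \<noteq> m\<close>.\<close>

lemma edge_ind_xor_m:
  assumes "m < 2 ^ n" "i < 2 ^ n" "k < 2 ^ n" "i \<noteq> 0" "k \<noteq> 0" "k \<noteq> m"
  shows "edge_ind m i (k XOR m) = edge_ind m i k"
proof -
  define j l where "j = i XOR m" and "l = k XOR m"
  have j: "j < 2 ^ n" and l: "l < 2 ^ n" "l \<noteq> 0"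
    using assms by (simp_all add: l_def j_def xor_less_power2)
  have eqs: "l XOR m = k" "l XOR j = i XOR k" "j XOR k = l XOR i"
    by (simp_all add: l_def j_def ac_simps)
  have "\<sigma> k j = cnj_sign j * cnj_sign k * cnj_sign (l XOR i) * \<sigma> j k"
    using \<sigma>_swap[OF j assms(3)] by (simp add: eqs)
  moreover have "\<sigma> i l = cnj_sign l * cnj_sign i * cnj_sign (l XOR i) * \<sigma> l i"
    using \<sigma>_swap[OF l(1) assms(2)] .
  moreover have "\<sigma> k i = cnj_sign i * cnj_sign k * cnj_sign (i XOR k) * \<sigma> i k"
    by (rule \<sigma>_swap) fact+
  moreover have "\<sigma> j l = cnj_sign l * cnj_sign j * cnj_sign (i XOR k) * \<sigma> l j"
    using \<sigma>_swap[OF l(1) j] by (simp add: eqs)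
  ultimately show ?thesis
    using assms j l
    by (simp add: edge_ind_def edge_sign_def j_def[symmetric] l_def[symmetric] eqs)
      (simp add: \<sigma>_square_left cnj_sign_def)
qed

text \<open>The partner of \<open>m\<close> is the index \<open>0\<close>, whose products have sign
  one; what remains is the square of $e_m$.\<close>

lemma edge_ind_hub:
  assumes "m < 2 ^ n" "k < 2 ^ n" "m \<noteq> 0" "k \<noteq> 0"
  shows "edge_ind m m k = chi m"
  using assms \<sigma>_right_xor[of k m] \<sigma>_swap[of m k]
  by (auto simp: edge_ind_def edge_sign_def chi_def basis_norm_def \<sigma>_0 \<sigma>_square xor_less_power2
      cnj_sign_def xor.commute[of m])

text \<open>For \<open>m = 0\<close> every index is its own partner, so the four signs cancel in
  pairs.\<close>

lemma edge_ind_0: "i < 2 ^ n \<Longrightarrow> k < 2 ^ n \<Longrightarrow> k \<noteq> 0 \<Longrightarrow> edge_ind 0 i k = \<gamma> n"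
  by (simp add: edge_ind_def edge_sign_def \<sigma>_square \<sigma>_square_left cnj_sign_def ac_simps)

section \<open>Adjacency with the top index\<close>

abbreviation T :: nat where "T \<equiv> 2 ^ (n - 1)"

lemma T_less: "T < 2 ^ n" and less_T_imp: "i < T \<Longrightarrow> i < 2 ^ n"
  and Suc_n: "n = Suc (n - 1)"
proof -
  show Sn: "n = Suc (n - 1)" using n by simp
  then have "(2 :: nat) ^ n = 2 * T" by (metis power_Suc)
  then show "T < 2 ^ n" "i < T \<Longrightarrow> i < 2 ^ n" by simp_all
qed

lemma less_2nE:
  assumes "i < 2 ^ n"
  obtains "i < T" | i' where "i' < T" "i = T XOR i'"
  using assms less_power2_SucE[of i "n - 1"] Suc_n by metis

text \<open>The last doubling step. As \<open>T\<close> is \<open>T XOR 0\<close>, its products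
  become products with the unit one level down.\<close>

lemma \<sigma>_split:
  assumes "i < T" "j < T"
  shows "\<sigma> i j = cd_sign \<gamma> (n - 1) i j"
    and "\<sigma> i (T XOR j) = cd_sign \<gamma> (n - 1) j i"
    and "\<sigma> (T XOR i) j = cnj_sign j * cd_sign \<gamma> (n - 1) i j"
    and "\<sigma> (T XOR i) (T XOR j) = \<gamma> (n - 1) * cnj_sign j * cd_sign \<gamma> (n - 1) j i"
  using cd_sign_Suc[OF assms] Suc_n by metis+

text \<open>One level down \<open>T\<close> acts as the unit. Left alternativity there turns the
  sign of the two partners into \<open>?s m m * ?s m k\<close>, and \<open>?s m k\<close>
  cancels.\<close>

lemma edge_ind_T_lower:
  assumes "m < T" "k < T" "m \<noteq> 0" "k \<noteq> 0" "k \<noteq> m"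
  shows "edge_ind m T k = - chi m"
proof -
  let ?s = "cd_sign \<gamma> (n - 1)"
  have km: "k XOR m < T" using assms by (simp add: xor_less_power2)
  have "\<sigma> (k XOR m) (T XOR m) = ?s m m * ?s m k"
    using \<sigma>_split(2)[OF km assms(1)] cd_sign_left_xor[OF \<gamma>_less' assms(1,2)] by (simp add: ac_simps)
  moreover have "\<sigma> T k = - 1" "\<sigma> (k XOR m) T = 1" "\<sigma> (T XOR m) k = - ?s m k" "\<sigma> m m = ?s m m"
    using \<sigma>_split(3)[of 0 k] \<sigma>_split(2)[OF km, of 0] \<sigma>_split(3)[OF assms(1,2)] assms
      cd_sign_0[OF \<gamma>_less'] km
    by (simp_all add: cnj_sign_def \<sigma>_split(1))
  ultimately show ?thesis
    using assms cd_sign_square[OF \<gamma>_less' assms(1,2)]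
    by (simp add: edge_ind_def edge_sign_def chi_def basis_norm_def cnj_sign_def)
qed

text \<open>Here the partner of \<open>T\<close> lies in the lower half and that of \<open>k\<close>
  in the upper one, so right alternativity takes the place of left.\<close>

lemma edge_ind_T_upper:
  assumes "m < T" "k < T" "m \<noteq> 0" "k \<noteq> 0" "k \<noteq> m"
  shows "edge_ind (T XOR m) T k = - chi (T XOR m)"
proof -
  let ?s = "cd_sign \<gamma> (n - 1)"
  have km: "k XOR m < T" using assms by (simp add: xor_less_power2)
  have "\<sigma> (T XOR (k XOR m)) m = - ?s m m * ?s k m"
    using \<sigma>_split(3)[OF km assms(1)] cd_sign_right_xor[OF \<gamma>_less' assms(2,1)] assms
    by (simp add: cnj_sign_def)
  moreover have "\<sigma> T k = - 1" "\<sigma> (T XOR (k XOR m)) T = \<gamma> (n - 1)" "\<sigma> m k = - ?s k m"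
     "\<sigma> (T XOR m) (T XOR m) = - \<gamma> (n - 1) * ?s m m"
    using \<sigma>_split(4)[OF assms(1,1)] \<sigma>_split(3)[of 0 k] \<sigma>_split(4)[OF km, of 0] \<sigma>_split(1)[OF assms(1,2)] assms
      cd_sign_0[OF \<gamma>_less'] km cd_sign_swap[OF \<gamma>_less' assms(2,1)]
    by (simp_all add: cnj_sign_def)
  moreover have "k XOR (T XOR m) = T XOR (k XOR m)" by (simp add: ac_simps)
  moreover have "T XOR (k XOR m) \<noteq> 0" "T XOR m \<noteq> 0" using km assms by auto
  ultimately show ?thesis
    using assms cd_sign_square[OF \<gamma>_less' assms(2,1)]
    by (simp add: edge_ind_def edge_sign_def chi_def basis_norm_def cnj_sign_def)
qed

text \<open>For \<open>chi m = - 1\<close>, the index \<open>T\<close> is adjacent to all others but \<open>T XOR m\<close>.\<close>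

lemma edge_ind_T:
  assumes "m < 2 ^ n" "k < 2 ^ n" "m \<noteq> 0" "m \<noteq> T" "k \<notin> {0, m, T, T XOR m}"
  shows "edge_ind m T k = - chi m"
proof -
  have *: "edge_ind m T k = - chi m" if "k < T" "k \<notin> {0, m, T XOR m}" for k
    using assms(1)
  proof (cases rule: less_2nE)
    case 1
    then show ?thesis using that assms by (intro edge_ind_T_lower) auto
  next
    case (2 m')
    then show ?thesis using that assms edge_ind_T_upper[of m' k] by auto
  qed
  from assms(2) show ?thesis
  proof (cases rule: less_2nE)
    case 1
    then show ?thesis using assms by (intro *) auto
  next
    case (2 k')
    then have "edge_ind m T k' = - chi m" using assms by (intro *) auto
    \<comment> \<open>By \<open>edge_ind_xor\<close> with \<open>T\<close>, an upper index can be
      moved to the lower half.\<close>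
    moreover have "edge_ind m T k = edge_ind m T k'"
      using 2 less_T_imp[of k'] assms edge_ind_xor[of m T k'] T_less by (auto dest: less_T_imp)
    ultimately show ?thesis by simp
  qed
qed

text \<open>In this class the partner of a lower index is its upper copy, so all signs are explicit
  for lower \<open>i\<close> and \<open>k\<close>; upper indices are replaced by their partners. The
  case is separate because for \<open>chi T = - 1\<close> the index \<open>T\<close> is itself
  excluded.\<close>

lemma edge_ind_m_eq_T:
  assumes "i < 2 ^ n" "k < 2 ^ n" "i \<notin> {0, T}" "k \<notin> {0, T, i, i XOR T}"
  shows "edge_ind T i k = - chi T"
proof -
  let ?s = "cd_sign \<gamma> (n - 1)"
  have *: "edge_ind T i k = - chi T" if "i < T" "k < T" "i \<noteq> 0" "k \<noteq> 0" "i \<noteq> k" for i k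
  proof -
    have "\<sigma> (T XOR k) (T XOR i) = - \<gamma> (n - 1) * ?s i k" "\<sigma> i k = ?s i k" "\<sigma> (T XOR k) i = ?s i k"
      "\<sigma> (T XOR i) k = - ?s i k" "\<sigma> T T = \<gamma> (n - 1)" "T XOR k \<noteq> 0"
      using that \<sigma>_split[of k i] \<sigma>_split[of i k] \<sigma>_split(4)[of 0 0] cd_sign_0[OF \<gamma>_less']
        cd_sign_swap[OF \<gamma>_less', of i k] by (auto simp: cnj_sign_def)
    moreover have "k XOR T = T XOR k" "i XOR T = T XOR i" by (simp_all only: xor.commute)
    ultimately show ?thesis
      using that cd_sign_cases[OF \<gamma>_less', of i k]
      by (auto simp: edge_ind_def edge_sign_def chi_def basis_norm_def cnj_sign_def)
  qed
  have **: "edge_ind T i k = - chi T" if "i < T" "i \<noteq> 0" "k < 2 ^ n" "k \<notin> {0, T, i, i XOR T}" for i k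
    using that(3)
  proof (cases rule: less_2nE)
    case 1
    then show ?thesis using that by (intro *) auto
  next
    case (2 k')
    then have "edge_ind T i k' = - chi T" using that by (intro *) (auto simp: xor.commute)
    moreover have "edge_ind T i k = edge_ind T i k'"
      using 2 that edge_ind_xor_m[of T i k'] T_less less_T_imp[of k'] less_T_imp[of i] by (auto dest: less_T_imp simp: xor.commute)
    ultimately show ?thesis by simp
  qed
  from assms(1) show ?thesis
  proof (cases rule: less_2nE)
    case 1
    then show ?thesis using assms by (intro **) auto
  next
    case (2 i')
    have i': "i' < 2 ^ n" "i' \<noteq> 0" "i' \<noteq> T" using 2 assms less_T_imp[of i'] by auto
    have "edge_ind T i' k = - chi T" using 2 assms by (intro **) (auto simp: xor.commute)
    moreover have "edge_ind T i k = edge_ind T i' k"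
      using edge_ind_xor_m[of T k i'] edge_ind_commute[of T k i] edge_ind_commute[of T k i']
        2 i' assms T_less by (auto simp: xor.commute)
    ultimately show ?thesis by simp
  qed
qed

text \<open>For \<open>m\<close> in \<open>graph_indices\<close>, the first indices of the zero
  divisors of class \<open>m\<close>, by \<open>zero_divisor_vertex_iff\<close>. The index
  \<open>m\<close> is paired with the unit, and for \<open>chi m = - 1\<close> that element can be
  cancelled.\<close>

definition index_set :: "nat \<Rightarrow> nat set" where
  "index_set m = {i. i < 2 ^ n \<and> i \<noteq> 0 \<and> (chi m = - 1 \<longrightarrow> i \<noteq> m)}"

section \<open>Common neighbours within a class\<close>

lemma ex_fresh:
  assumes "finite (S :: nat set)" "card S < 8"
  obtains q :: nat where "q < 2 ^ n" "q \<notin> S"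
proof -
  \<comment> \<open>From \<open>n \<ge> 3\<close> come at least eight indices, enough to avoid
    seven.\<close>
  have "(2 :: nat) ^ 3 \<le> 2 ^ n" using n by (intro power_increasing) auto
  then have "card S < card {..<(2 :: nat) ^ n}" using assms by simp
  then have "\<not> {..<2 ^ n} \<subseteq> S" using assms(1) card_mono by (meson not_less)
  then show thesis using that by auto
qed

text \<open>Class \<open>0\<close> consists of the lines through $(e_i, s e_i)$; these are zero
  divisors only if \<open>chi 0\<close>, which is \<open>\<gamma> n\<close>, equals
  \<open>1\<close>.\<close>

definition graph_indices :: "nat set" where
  "graph_indices = {m. m < 2 ^ n \<and> (chi m = - 1 \<longrightarrow> m \<noteq> 0)}"

text \<open>In class \<open>0\<close> any fresh index serves. Otherwise \<open>m\<close> is the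
  common neighbour; if one endpoint is \<open>m\<close>, the partner of the other is taken, since
  \<open>m\<close>, \<open>j\<close>, \<open>j XOR m\<close> form a triangle, and if both are, any
  fresh index.\<close>

lemma ex_midpoint_pos:
  assumes "m < 2 ^ n" "chi m = 1" "i \<in> index_set m" "k \<in> index_set m"
  shows "\<exists>q < 2 ^ n. q \<noteq> 0 \<and> q \<noteq> k \<and> edge_ind m i q = 1 \<and> edge_ind m q k = 1"
proof (cases "m = 0")
  case True
  obtain q where q: "q < 2 ^ n" "q \<notin> {0, i, k}"
    by (rule ex_fresh[of "{0, i, k}"]) (auto simp: card_insert_if)
  then show ?thesis
    using assms True by (intro exI[of _ q])
      (auto simp: edge_ind_0 index_set_def chi_def basis_norm_def cnj_sign_def \<sigma>_0)
next
  case False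
  have ik: "i < 2 ^ n" "k < 2 ^ n" "i \<noteq> 0" "k \<noteq> 0"
    using assms by (auto simp: index_set_def)
  have hub: "edge_ind m m j = 1" "edge_ind m j m = 1" if "j < 2 ^ n" "j \<noteq> 0" for j
    using edge_ind_hub[of m j] edge_ind_commute[of m m j] False assms that by auto
  have opp: "edge_ind m j (j XOR m) = 1" if "j < 2 ^ n" "j \<noteq> 0" "j \<noteq> m" for j
    using edge_ind_xor[of m j m] hub that False assms by simp
  have opp': "edge_ind m (j XOR m) j = 1" if "j < 2 ^ n" "j \<noteq> 0" "j \<noteq> m" for j
    using opp[OF that] edge_ind_commute[of m j "j XOR m"] that assms by (simp add: xor_less_power2)
  consider "k \<noteq> m" "i \<noteq> m" | "k \<noteq> m" "i = m" | "k = m" "i \<noteq> m" | "k = m" "i = m" by blast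
  then show ?thesis
  proof cases
    case 1
    then show ?thesis using hub ik False assms(1) by (intro exI[of _ m]) auto
  next
    case 2
    then show ?thesis
      using hub opp' ik False assms(1) by (intro exI[of _ "k XOR m"]) (auto simp: xor_less_power2)
  next
    case 3
    then show ?thesis
      using hub opp ik False assms(1) by (intro exI[of _ "i XOR m"]) (auto simp: xor_less_power2)
  next
    case 4
    obtain q where "q < 2 ^ n" "q \<notin> {0, m}"
      by (rule ex_fresh[of "{0, m}"]) (auto simp: card_insert_if)
    then show ?thesis using 4 hub by (intro exI[of _ q]) auto
  qed
qed

text \<open>Now \<open>m\<close> is excluded, and \<open>T\<close> takes its role unless
  \<open>m = T\<close>. The conclusions \<open>q \<noteq> m\<close> and
  \<open>q \<noteq> k XOR m\<close> put \<open>q\<close> and the third index \<open>q XOR k\<close>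
  of the triangle into \<open>index_set m\<close>.\<close>

lemma ex_midpoint_neg:
  assumes "m < 2 ^ n" "m \<noteq> 0" "chi m = - 1" "i \<in> index_set m" "k \<in> index_set m"
  shows "\<exists>q < 2 ^ n. q \<noteq> 0 \<and> q \<noteq> m \<and> q \<noteq> k \<and> q \<noteq> k XOR m \<and> edge_ind m i q = 1 \<and> edge_ind m q k = 1"
proof (cases "m = T")
  case True
  \<comment> \<open>By \<open>edge_ind_m_eq_T\<close> it suffices to avoid \<open>0\<close>,
    \<open>T\<close>, the endpoints and their partners, at most six values.\<close>
  obtain q where q: "q < 2 ^ n" "q \<notin> {0, T, i, i XOR T, k, k XOR T}"
    by (rule ex_fresh[of "{0, T, i, i XOR T, k, k XOR T}"]) (auto simp: card_insert_if)
  then have "k \<noteq> q XOR T" by auto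
  then have "edge_ind T i q = 1" "edge_ind T q k = 1"
    using edge_ind_m_eq_T[of i q] edge_ind_m_eq_T[of q k] q assms True
    by (auto simp: index_set_def)
  then show ?thesis using True q by (intro exI[of _ q]) auto
next
  case False
  \<comment> \<open>\<open>T\<close> and its partner, both adjacent to every index outside
    \<open>{0, m, T, T XOR m}\<close>.\<close>
  let ?S = "{T, T XOR m}"
  have ik: "i < 2 ^ n" "k < 2 ^ n" "i \<noteq> 0" "k \<noteq> 0" "i \<noteq> m" "k \<noteq> m"
    using assms by (auto simp: index_set_def)
  have Tm: "T XOR m < 2 ^ n" "T XOR m \<noteq> 0" using False assms(1) T_less by (auto simp: xor_less_power2)
  have hub: "edge_ind m h j = 1" "edge_ind m j h = 1"
    if "h \<in> ?S" "j < 2 ^ n" "j \<notin> {0, m, T, T XOR m}" for h j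
  proof -
    have T: "edge_ind m T j = 1" using edge_ind_T[of m j] assms that False by auto
    have T': "edge_ind m j T = 1"
      using T edge_ind_commute[of m T j] assms(1) T_less that by auto
    moreover have "edge_ind m j (T XOR m) = 1"
      using T' edge_ind_xor_m[of m j T] assms(1) T_less that False by auto
    ultimately show jh: "edge_ind m j h = 1" using that(1) by auto
    then show "edge_ind m h j = 1"
      using edge_ind_commute[of m j h] assms(1) T_less that Tm by auto
  qed
  have opp: "edge_ind m j (j XOR T) = 1" "edge_ind m (j XOR T) j = 1"
    if "j < 2 ^ n" "j \<notin> {0, m, T, T XOR m}" for j
  proof -
    show "edge_ind m j (j XOR T) = 1"
      using edge_ind_xor[of m j T] hub(2)[of T j] T_less assms(1) that by auto
    then show "edge_ind m (j XOR T) j = 1"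
      using edge_ind_commute[of m j "j XOR T"] T_less assms(1) that by (auto simp: xor_less_power2)
  qed
  have jT: "j XOR T \<notin> {0, m, T, T XOR m} \<and> j XOR T < 2 ^ n \<and> j XOR T \<noteq> j"
    if "j < 2 ^ n" "j \<notin> {0, m, T, T XOR m}" for j
  proof -
    have "j XOR T = T XOR j" by (simp only: xor.commute)
    then show ?thesis using that T_less by (auto simp: xor_less_power2)
  qed
  \<comment> \<open>If exactly one endpoint lies in \<open>?S\<close>, then \<open>j XOR T\<close>
    for the other endpoint \<open>j\<close> works: it is joined to \<open>j\<close> by the triangle
    with \<open>T\<close>, and to all of \<open>?S\<close> because it avoids the exceptional
    indices.\<close>
  consider "k \<notin> ?S" "i \<notin> ?S" | "k \<notin> ?S" "i \<in> ?S" | "k \<in> ?S" "i \<notin> ?S" | "k \<in> ?S" "i \<in> ?S" by blast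
  then show ?thesis
  proof cases
    case 1
    then show ?thesis using hub[of T] ik False assms(1) T_less by (intro exI[of _ T]) (auto simp: ac_simps)
  next
    case 2
    then show ?thesis
      using hub[OF 2(2), of "k XOR T"] opp[of k] jT[of k] ik False assms(1)
      by (intro exI[of _ "k XOR T"]) (auto simp: ac_simps)
  next
    case 3
    then show ?thesis
      using hub[OF 3(1), of "i XOR T"] opp[of i] jT[of i] ik False assms(1)
      by (intro exI[of _ "i XOR T"]) (auto simp: ac_simps)
  next
    case 4
    obtain q where "q < 2 ^ n" "q \<notin> {0, m, T, T XOR m}"
      by (rule ex_fresh[of "{0, m, T, T XOR m}"]) (auto simp: card_insert_if)
    then show ?thesis using 4 hub by (intro exI[of _ q]) (auto simp: ac_simps)
  qed
qed

text \<open>The third point of the line through \<open>q\<close> and \<open>k\<close> closes a triangle of negative sign.\<close>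

lemma ex_midpoint:
  assumes "m \<in> graph_indices" "i \<in> index_set m" "k \<in> index_set m"
  obtains q r where "q \<in> index_set m" "r \<in> index_set m"
    "edge_ind m i q = 1" "edge_ind m q k = 1" "edge_ind m q r = 1" "edge_ind m r k = 1"
    "edge_sign m q r * edge_sign m r k = - edge_sign m q k"
proof -
  have m: "m < 2 ^ n" "chi m = - 1 \<Longrightarrow> m \<noteq> 0" using assms(1) by (auto simp: graph_indices_def)
  have k: "k < 2 ^ n" "k \<noteq> 0" using assms(3) by (auto simp: index_set_def)
  obtain q where q: "q < 2 ^ n" "q \<noteq> 0" "q \<noteq> k" "edge_ind m i q = 1" "edge_ind m q k = 1"
    "chi m = - 1 \<longrightarrow> q \<noteq> m \<and> q \<noteq> k XOR m"
  proof (cases "chi m = - 1")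
    case True
    then show thesis using ex_midpoint_neg[OF m(1) m(2) _ assms(2,3)] that by blast
  next
    case False
    then have "chi m = 1" using chi_cases[OF m(1)] by auto
    then show thesis using ex_midpoint_pos[OF m(1) _ assms(2,3)] that by auto
  qed
  let ?r = "q XOR k"
  have r: "?r < 2 ^ n" "?r \<noteq> 0" using q k by (auto simp: xor_less_power2)
  have "q \<in> index_set m" using q by (auto simp: index_set_def)
  moreover have "?r \<in> index_set m"
    using q r by (auto simp: index_set_def ac_simps)
  moreover have "edge_ind m q ?r = 1" using edge_ind_xor[of m q k] m q k by auto
  moreover have "edge_ind m ?r k = 1"
    using edge_ind_xor[of m k q] edge_ind_commute[of m k q] edge_ind_commute[of m ?r k] m q k r
    by (auto simp: xor.commute)
  moreover have "edge_sign m q ?r * edge_sign m ?r k = - edge_sign m q k"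
    using edge_sign_triangle[of m q k] m q k r edge_sign_cases[of m q k] edge_sign_commute[of m ?r]
    by (auto simp: mult.commute)
  ultimately show thesis using that q by blast
qed

end

section \<open>Zero divisors and orthogonality\<close>

lemma cd_scale_zero_iff: "x \<in> cd_carrier k \<Longrightarrow> cd_scale r x = cd_zero k \<longleftrightarrow> r = 0 \<or> x = cd_zero k"
  by (induction k arbitrary: x) auto

lemma cd_scale_eq_self: "x \<in> cd_carrier k \<Longrightarrow> cd_scale r x = x \<Longrightarrow> r \<noteq> 1 \<Longrightarrow> x = cd_zero k"
proof (induction k arbitrary: x)
  case (Suc k)
  from Suc.prems(1) obtain a b where "x = Pr a b" "a \<in> cd_carrier k" "b \<in> cd_carrier k" by auto
  with Suc.IH[of a] Suc.IH[of b] Suc.prems(2,3) show ?case by simp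
qed auto

lemma cd_cnj_eq_zero_iff: "cd_cnj x = cd_zero k \<longleftrightarrow> x = cd_zero k"
  by (metis cd_cnj_cnj cd_cnj_zero)

lemma cd_mult_unit:
  "x \<in> cd_carrier k \<Longrightarrow> cd_mult \<gamma> k (cd_basis k 0) x = x \<and> cd_mult \<gamma> k x (cd_basis k 0) = x"
proof (induction k arbitrary: x)
  case (Suc k)
  have "cd_cnj (cd_basis k 0) = cd_basis k 0"
    by (simp add: cd_cnj_basis cnj_sign_def cd_scale_one)
  with Suc show ?case
    by (auto simp: cd_mult_zero cd_cnj_zero cd_scale_zero cd_add_zero cd_closed)
qed auto

text \<open>The conjugate of $uv$ is $(-v)(-u)$. For imaginary elements the two halves of
  orthogonality are therefore equivalent.\<close>

lemma cd_mult_imaginary_swap: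
  assumes "u \<in> cd_carrier k" "v \<in> cd_carrier k" "cd_cnj u = cd_uminus u" "cd_cnj v = cd_uminus v"
  shows "cd_mult \<gamma> k v u = cd_cnj (cd_mult \<gamma> k u v)"
  using assms by (simp add: cd_cnj_mult cd_mult_scale cd_closed cd_scale_scale cd_scale_one)

lemma cd_norm_basis:
  assumes "j < 2 ^ k" "s \<in> {1, - 1}"
  shows "cd_norm \<gamma> k (cd_scale s (cd_basis k j)) = basis_norm \<gamma> k j"
proof -
  have "cd_scale (cd_norm \<gamma> k (cd_scale s (cd_basis k j))) (cd_basis k 0) =
        cd_scale (basis_norm \<gamma> k j) (cd_basis k 0)"
    using assms
    by (subst cd_norm_eq(1)[symmetric])
      (auto simp: cd_closed cd_cnj_scale cd_cnj_basis cd_mult_scale cd_basis_mult cd_scale_scale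
        basis_norm_def)
  then show ?thesis by (rule cd_basis_0_scale_inj)
qed

lemma cd_basis_eq_iff: "i < 2 ^ k \<Longrightarrow> j < 2 ^ k \<Longrightarrow> cd_basis k i = cd_basis k j \<longleftrightarrow> i = j"
  using cd_scale_basis_eq_iff[of i k j 1 1] by (simp add: cd_scale_one)

lemma cd_E'_eq: "cd_E' k = cd_basis k ` {0<..<2 ^ k}"
  by (auto simp: cd_E'_def cd_E_def cd_basis_eq_iff)

lemma cd_pmE_eq: "cd_pmE k = {cd_scale s (cd_basis k j) | s j. s \<in> {1, - 1} \<and> j < 2 ^ k}"
  by (auto simp: cd_pmE_def cd_E_def) (metis cd_scale_one image_eqI lessThan_iff)+

section \<open>Products, orthogonality and cancellation of vertices\<close>

context cd_graph
begin

text \<open>The second index is coded by its exclusive or \<open>m\<close> with the first, because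
  \<open>m\<close> is constant along edges.\<close>

definition vertex :: "nat \<Rightarrow> nat \<Rightarrow> real \<Rightarrow> cd" where
  "vertex m i s = Pr (cd_basis n i) (cd_scale s (cd_basis n (i XOR m)))"

lemma vertex_closed: "vertex m i s \<in> cd_carrier (Suc n)"
  by (simp add: vertex_def cd_closed)

lemma vertex_neq_zero: "i < 2 ^ n \<Longrightarrow> vertex m i s \<noteq> cd_zero (Suc n)"
  using cd_scale_eq_zero_iff[of i n 1] by (simp add: vertex_def cd_scale_one)

lemma cd_cnj_vertex: "i < 2 ^ n \<Longrightarrow> i \<noteq> 0 \<Longrightarrow> cd_cnj (vertex m i s) = cd_uminus (vertex m i s)"
  by (simp add: vertex_def cd_cnj_basis cnj_sign_def)

text \<open>Each component of the product is a sum of two signed basis elements, which vanishes only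
  if these agree up to sign; this forces \<open>m = m'\<close>. The second component then fixes
  \<open>s * t\<close>, and with this value the first says
  \<open>edge_ind m i k = 1\<close>.\<close>

lemma cd_mult_vertex_eq_zero_iff:
  assumes "m < 2 ^ n" "m' < 2 ^ n" "i < 2 ^ n" "k < 2 ^ n" "i \<noteq> 0" "k \<noteq> 0"
    and s: "s \<in> {1, - 1}" and t: "t \<in> {1, - 1}"
  shows "cd_mult \<gamma> (Suc n) (vertex m i s) (vertex m' k t) = cd_zero (Suc n) \<longleftrightarrow>
    m = m' \<and> s * t = edge_sign m i k \<and> edge_ind m i k = 1"
proof -
  define j l where "j = i XOR m" and "l = k XOR m'"
  have jl: "j < 2 ^ n" "l < 2 ^ n" using assms by (simp_all add: j_def l_def xor_less_power2)
  note pm = \<sigma>_cases[OF assms(3,4)] \<sigma>_cases[OF jl(2,1)] \<sigma>_cases[OF jl(2) assms(3)]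
    \<sigma>_cases[OF jl(1) assms(4)]
  have eq: "i XOR k = l XOR j \<longleftrightarrow> m = m'" "l XOR i = j XOR k \<longleftrightarrow> m = m'"
  proof -
    have "l XOR j = (i XOR k) XOR (m XOR m')" "j XOR k = (i XOR k) XOR m" "l XOR i = (i XOR k) XOR m'"
      by (simp_all add: j_def l_def ac_simps)
    moreover have "i XOR k = (i XOR k) XOR (m XOR m') \<longleftrightarrow> m = m'"
      by (metis xor_eq_self_iff(1) xor_eq_0_iff)
    ultimately show "i XOR k = l XOR j \<longleftrightarrow> m = m'" "l XOR i = j XOR k \<longleftrightarrow> m = m'" by auto
  qed
  have "cd_mult \<gamma> (Suc n) (vertex m i s) (vertex m' k t) = cd_zero (Suc n) \<longleftrightarrow>
    cd_add (cd_scale (\<sigma> i k) (cd_basis n (i XOR k)))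
      (cd_scale (\<gamma> n * (cnj_sign l * t * s * \<sigma> l j)) (cd_basis n (l XOR j))) = cd_zero n \<and>
    cd_add (cd_scale (t * \<sigma> l i) (cd_basis n (l XOR i)))
      (cd_scale (- s * \<sigma> j k) (cd_basis n (j XOR k))) = cd_zero n"
    using assms(3-6) jl
    by (simp add: vertex_def j_def[symmetric] l_def[symmetric] cd_cnj_scale cd_cnj_basis cd_mult_scale
        cd_closed cd_basis_mult cd_scale_scale cnj_sign_def mult.assoc)
      (simp add: ac_simps)
  also have "\<dots> \<longleftrightarrow> m = m' \<and> \<sigma> i k + \<gamma> n * (cnj_sign l * t * s * \<sigma> l j) = 0 \<and> t * \<sigma> l i - s * \<sigma> j k = 0"
    using assms(3,4) jl pm s t by (auto simp: cd_add_scale_basis_eq_zero_iff xor_less_power2 eq)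
  also have "t * \<sigma> l i - s * \<sigma> j k = 0 \<longleftrightarrow> s * t = \<sigma> l i * \<sigma> j k"
    using pm s t by auto
  also have "m = m' \<and> \<sigma> i k + \<gamma> n * (cnj_sign l * t * s * \<sigma> l j) = 0 \<and> s * t = \<sigma> l i * \<sigma> j k \<longleftrightarrow>
      m = m' \<and> s * t = edge_sign m i k \<and> edge_ind m i k = 1"
  \<comment> \<open>Once \<open>s * t\<close> is the edge sign, multiplying the first equation by
    \<open>\<sigma> i k\<close> isolates the indicator.\<close>
  proof (cases "m = m' \<and> s * t = \<sigma> l i * \<sigma> j k")
    case True
    then have e: "edge_sign m i k = s * t" by (simp add: edge_sign_def j_def l_def)
    moreover have "s * t \<in> {1, - 1}" using s t by auto
    moreover have "edge_ind m i k = - (\<gamma> n * (cnj_sign l * t * s * \<sigma> l j)) * \<sigma> i k"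
      using True e by (simp add: edge_ind_def j_def l_def ac_simps)
    ultimately show ?thesis using True pm(1) by auto
  next
    case False
    then show ?thesis by (auto simp: edge_sign_def j_def l_def)
  qed
  finally show ?thesis .
qed

text \<open>Vertices are imaginary, so a single product decides.\<close>

lemma cd_orthogonal_vertex_iff:
  assumes "m < 2 ^ n" "m' < 2 ^ n" "i < 2 ^ n" "k < 2 ^ n" "i \<noteq> 0" "k \<noteq> 0"
    and "s \<in> {1, - 1}" "t \<in> {1, - 1}"
  shows "cd_orthogonal \<gamma> (Suc n) (vertex m i s) (vertex m' k t) \<longleftrightarrow>
    m = m' \<and> s * t = edge_sign m i k \<and> edge_ind m i k = 1"
  unfolding cd_mult_vertex_eq_zero_iff[OF assms, symmetric]
  using cd_mult_imaginary_swap[of "vertex m i s" "Suc n" "vertex m' k t" \<gamma>, OF vertex_closed vertex_closed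
      cd_cnj_vertex[OF assms(3,5)] cd_cnj_vertex[OF assms(4,6)]]
  by (simp only: cd_orthogonal_def cd_cnj_eq_zero_iff conj_absorb)

text \<open>The case \<open>i = m\<close>, with a multiple of the unit as second component. Here
  \<open>chi i = - 1\<close> means that $e_i$ squares to \<open>\<gamma> n\<close>; solving the
  second equation for \<open>c\<close> and inserting it into the first doubles the conjugate of
  \<open>d\<close> instead of cancelling it.\<close>

lemma vertex_cancel_unit:
  assumes "i < 2 ^ n" "i \<noteq> 0" "chi i = - 1" "s \<in> {1, - 1}" "y \<in> cd_carrier (Suc n)"
    and "cd_mult \<gamma> (Suc n) (vertex i i s) y = cd_zero (Suc n)"
  shows "y = cd_zero (Suc n)"
proof -
  obtain c d where y: "y = Pr c d" and [simp]: "c \<in> cd_carrier n" "d \<in> cd_carrier n"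
    using assms(5) by auto
  define a where "a = cd_basis n i"
  have a [simp]: "a \<in> cd_carrier n" "cd_cnj a = cd_uminus a"
    using assms(1,2) by (simp_all add: a_def cd_closed cd_cnj_basis cnj_sign_def)
  have "\<sigma> i i = \<gamma> n"
    using assms \<gamma> \<sigma>_cases[of i i] by (auto simp: chi_def basis_norm_def cnj_sign_def)
  then have aa: "cd_mult \<gamma> n a (cd_mult \<gamma> n a x) = cd_scale (\<gamma> n) x" if "x \<in> cd_carrier n" for x
    using cd_basis_alternative[OF assms(1) that, of \<gamma>] by (simp add: a_def)
  have 1: "cd_add (cd_mult \<gamma> n a c) (cd_scale (\<gamma> n * s) (cd_cnj d)) = cd_zero n"
    and 2: "cd_add (cd_mult \<gamma> n d a) (cd_scale s (cd_cnj c)) = cd_zero n"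
    using assms(6)
    by (simp_all add: vertex_def y a_def[symmetric] cd_mult_scale cd_closed cd_mult_unit cd_scale_scale)
  have "cd_cnj c = cd_scale s (cd_scale s (cd_cnj c))"
    using assms(4) by (auto simp: cd_scale_scale cd_scale_one)
  also have "\<dots> = cd_scale (- s) (cd_mult \<gamma> n d a)"
    using 2 by (simp add: cd_add_eq_zero_iff[of _ n] cd_closed cd_scale_scale)
  finally have "c = cd_cnj (cd_scale (- s) (cd_mult \<gamma> n d a))" using cd_cnj_cnj by metis
  then have c: "c = cd_scale s (cd_mult \<gamma> n a (cd_cnj d))"
    by (simp add: cd_cnj_scale cd_cnj_mult cd_mult_scale cd_closed cd_scale_scale)
  then have "cd_mult \<gamma> n a c = cd_scale (s * \<gamma> n) (cd_cnj d)"
    by (simp add: cd_mult_scale cd_closed aa cd_scale_scale)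
  with 1 have "cd_scale (\<gamma> n * s + \<gamma> n * s) (cd_cnj d) = cd_zero n"
    by (simp only: cd_scale_add_distrib mult.commute)
  then have "cd_cnj d = cd_zero n"
    using assms(4) \<gamma> by (auto simp: cd_scale_zero_iff cd_closed)
  then show ?thesis
    using c by (simp add: y cd_mult_zero cd_scale_zero cd_cnj_zero cd_cnj_eq_zero_iff)
qed

text \<open>The case \<open>m = 0\<close>, where both components are multiples of \<open>a\<close>.
  Solving the second equation for \<open>d\<close> and inserting its conjugate into the first yields
  $ac = -ac$; alternativity and flexibility of \<open>a\<close> stand in for associativity.\<close>

lemma vertex_cancel_diag:
  assumes "i < 2 ^ n" "i \<noteq> 0" "chi 0 = - 1" "s \<in> {1, - 1}" "y \<in> cd_carrier (Suc n)"
    and "cd_mult \<gamma> (Suc n) (vertex 0 i s) y = cd_zero (Suc n)"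
  shows "y = cd_zero (Suc n)"
proof -
  obtain c d where y: "y = Pr c d" and [simp]: "c \<in> cd_carrier n" "d \<in> cd_carrier n"
    using assms(5) by auto
  define a z where "a = cd_basis n i" and "z = \<sigma> i i"
  have a [simp]: "a \<in> cd_carrier n" "cd_cnj a = cd_uminus a"
    using assms(1,2) by (simp_all add: a_def cd_closed cd_cnj_basis cnj_sign_def)
  have zz [simp]: "z * z = 1" "z * (z * x) = x" for x
    using assms(1) by (simp_all add: z_def \<sigma>_square \<sigma>_square_left)
  have ss [simp]: "s * s = 1" "s * (s * x) = x" for x using assms(4) by auto
  have \<gamma>n: "\<gamma> n = - 1"
    using assms \<gamma> by (auto simp: chi_def basis_norm_def cnj_sign_def \<sigma>_0)
  have aa: "cd_mult \<gamma> n a (cd_mult \<gamma> n a x) = cd_scale z x"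
    "cd_mult \<gamma> n (cd_mult \<gamma> n x a) a = cd_scale z x"
    "cd_mult \<gamma> n a (cd_mult \<gamma> n x a) = cd_mult \<gamma> n (cd_mult \<gamma> n a x) a"
    if "x \<in> cd_carrier n" for x
    using cd_basis_alternative[OF assms(1) that, of \<gamma>] cd_basis_flexible[OF assms(1) that, of \<gamma>]
    by (simp_all add: a_def z_def)
  have 1: "cd_mult \<gamma> n a c = cd_scale s (cd_mult \<gamma> n (cd_cnj d) a)"
  proof -
    have "cd_add (cd_scale (- s) (cd_mult \<gamma> n (cd_cnj d) a)) (cd_mult \<gamma> n a c) = cd_zero n"
      using assms(6)
      by (simp add: vertex_def y a_def[symmetric] cd_mult_scale cd_closed cd_scale_scale \<gamma>n cd_add_commute[of _ n])
    then show ?thesis by (simp add: cd_add_eq_zero_iff[of _ n] cd_closed cd_scale_scale)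
  qed
  have 2: "cd_mult \<gamma> n d a = cd_scale (- s) (cd_mult \<gamma> n a (cd_cnj c))"
  proof -
    have "cd_add (cd_scale s (cd_mult \<gamma> n a (cd_cnj c))) (cd_mult \<gamma> n d a) = cd_zero n"
      using assms(6)
      by (simp add: vertex_def y a_def[symmetric] cd_mult_scale cd_closed cd_scale_scale cd_add_commute[of _ n])
    then show ?thesis by (simp add: cd_add_eq_zero_iff[of _ n] cd_closed cd_scale_scale)
  qed
  \<comment> \<open>Right multiplication by \<open>a\<close> is undone by repeating it and scaling
    by its square \<open>z\<close>.\<close>
  have "d = cd_scale z (cd_mult \<gamma> n (cd_mult \<gamma> n d a) a)"
    by (simp add: aa cd_scale_scale cd_scale_one)
  also have "\<dots> = cd_scale (- (z * s)) (cd_mult \<gamma> n (cd_mult \<gamma> n a (cd_cnj c)) a)"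
    by (simp add: 2 cd_mult_scale cd_closed cd_scale_scale)
  finally have d: "d = cd_scale (- (z * s)) (cd_mult \<gamma> n (cd_mult \<gamma> n a (cd_cnj c)) a)" .
  then have "cd_cnj d = cd_cnj (cd_scale (- (z * s)) (cd_mult \<gamma> n (cd_mult \<gamma> n a (cd_cnj c)) a))"
    by (rule arg_cong)
  \<comment> \<open>Conjugation reverses the product to $a(ca)$, the signs of the two factors
    cancelling; flexibility makes it $(ac)a$.\<close>
  also have "\<dots> = cd_scale (- (z * s)) (cd_mult \<gamma> n (cd_mult \<gamma> n a c) a)"
    by (simp add: cd_cnj_scale cd_cnj_mult cd_cnj_cnj cd_mult_scale cd_closed cd_scale_scale aa)
  finally have cnj_d: "cd_cnj d = cd_scale (- (z * s)) (cd_mult \<gamma> n (cd_mult \<gamma> n a c) a)" .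
  have "cd_mult \<gamma> n a c =
      cd_scale s (cd_mult \<gamma> n (cd_scale (- (z * s)) (cd_mult \<gamma> n (cd_mult \<gamma> n a c) a)) a)"
    using 1 by (simp only: cnj_d)
  also have "\<dots> = cd_scale (- 1) (cd_mult \<gamma> n a c)"
    by (simp add: cd_mult_scale cd_closed cd_scale_scale aa ac_simps)
  finally have "cd_mult \<gamma> n a c = cd_scale (- 1) (cd_mult \<gamma> n a c)" .
  then have "cd_mult \<gamma> n a c = cd_zero n"
    by (intro cd_scale_eq_self[of _ n "- 1"]) (simp_all add: cd_closed)
  then have "cd_scale z c = cd_zero n" using aa(1)[of c] by (simp add: cd_mult_zero)
  moreover have "z \<noteq> 0" using zz(1) by (metis mult_zero_left zero_neq_one)
  ultimately have "c = cd_zero n" by (simp add: cd_scale_zero_iff)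
  then show ?thesis using d by (simp add: y cd_cnj_zero cd_mult_zero cd_scale_zero)
qed

text \<open>A neighbour from \<open>ex_midpoint\<close> is an annihilator. The excluded cases
  \<open>m = 0\<close> and \<open>i = m\<close> with characteristic $-1$ are ruled out by the two
  cancellation lemmas.\<close>

lemma zero_divisor_vertex_iff:
  assumes "m < 2 ^ n" "i < 2 ^ n" "i \<noteq> 0" "s \<in> {1, - 1}"
  shows "cd_zero_divisor \<gamma> (Suc n) (vertex m i s) \<longleftrightarrow> m \<in> graph_indices \<and> i \<in> index_set m"
proof
  assume "m \<in> graph_indices \<and> i \<in> index_set m"
  then obtain q where q: "q \<in> index_set m" "edge_ind m i q = 1"
    using ex_midpoint[of m i i] by blast
  have "q < 2 ^ n" "q \<noteq> 0" using q by (auto simp: index_set_def)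
  moreover have "s * edge_sign m i q \<in> {1, - 1}"
    using edge_sign_cases[of m i q] assms \<open>q < 2 ^ n\<close> by auto
  moreover have "s * s = 1" using assms by auto
  ultimately have "cd_mult \<gamma> (Suc n) (vertex m i s) (vertex m q (s * edge_sign m i q)) = cd_zero (Suc n)"
    using q(2) assms by (subst cd_mult_vertex_eq_zero_iff) (auto simp flip: mult.assoc)
  then show "cd_zero_divisor \<gamma> (Suc n) (vertex m i s)"
    using vertex_closed vertex_neq_zero \<open>q < 2 ^ n\<close> assms(2) unfolding cd_zero_divisor_def by blast
next
  assume zd: "cd_zero_divisor \<gamma> (Suc n) (vertex m i s)"
  show "m \<in> graph_indices \<and> i \<in> index_set m"
  proof (rule ccontr)
    assume "\<not> ?thesis"
    then have *: "chi m = - 1" "m = 0 \<or> i = m"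
      using assms by (auto simp: graph_indices_def index_set_def)
    have cancel: "y = cd_zero (Suc n)"
      if "y \<in> cd_carrier (Suc n)" "cd_mult \<gamma> (Suc n) (vertex m i s) y = cd_zero (Suc n)" for y
      using *(2) vertex_cancel_diag[OF assms(2,3) _ assms(4) that(1)]
        vertex_cancel_unit[OF assms(2,3) _ assms(4) that(1)] *(1) that(2) by blast
    obtain y where y: "y \<in> cd_carrier (Suc n)" "y \<noteq> cd_zero (Suc n)"
      "cd_mult \<gamma> (Suc n) (vertex m i s) y = cd_zero (Suc n) \<or>
       cd_mult \<gamma> (Suc n) y (vertex m i s) = cd_zero (Suc n)"
      using zd unfolding cd_zero_divisor_def by blast
    \<comment> \<open>If \<open>y\<close> annihilates the imaginary vertex from the left, its
      conjugate does so from the right.\<close>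
    moreover have "cd_mult \<gamma> (Suc n) y (vertex m i s) \<noteq> cd_zero (Suc n)"
    proof
      assume "cd_mult \<gamma> (Suc n) y (vertex m i s) = cd_zero (Suc n)"
      then have "cd_cnj (cd_mult \<gamma> (Suc n) y (vertex m i s)) = cd_zero (Suc n)"
        by (simp only: cd_cnj_zero)
      then have "cd_mult \<gamma> (Suc n) (vertex m i s) (cd_cnj y) = cd_zero (Suc n)"
        by (simp only: cd_cnj_mult[OF y(1) vertex_closed] cd_cnj_vertex[OF assms(2,3)]
           cd_mult_scale(1)[OF vertex_closed cd_cnj_closed[OF y(1)]]
           cd_scale_zero_iff[OF cd_mult_closed[OF vertex_closed cd_cnj_closed[OF y(1)]]]) simp
      then have "cd_cnj y = cd_zero (Suc n)" using cancel cd_cnj_closed[OF y(1)] by blast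
      then show False using y(2) cd_cnj_eq_zero_iff by blast
    qed
    ultimately show False using cancel by blast
  qed
qed

end

section \<open>Components and their diameter\<close>

lemma (in wf_digraph) awalk_cost_1: "awalk_cost (\<lambda>_. 1) p = length p"
  by (induction p) auto

lemma (in wf_digraph) ex_awalk_reflcl:
  assumes "(u, v) \<in> (arcs_ends G)\<^sup>=" "u \<in> verts G"
  shows "\<exists>p. awalk u p v \<and> length p \<le> 1"
proof (cases "u = v")
  case True
  then show ?thesis using assms(2) by (intro exI[of _ "[]"]) (simp add: awalk_Nil_iff)
next
  case False
  then obtain e where "e \<in> arcs G" "tail G e = u" "head G e = v"
    using assms(1) by (auto simp: arcs_ends_conv)
  then show ?thesis by (intro exI[of _ "[e]"]) (auto intro: arc_implies_awalk)
qed

text \<open>Walks of bounded length are expressed by composing the reflexive closure of adjacency;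
  the pair \<open>a\<close>, \<open>b\<close> witnesses the lower bound.\<close>

lemma (in wf_digraph) graph_diameter_eq_3:
  assumes le: "\<And>u v. u \<in> verts G \<Longrightarrow> v \<in> verts G \<Longrightarrow>
      (u, v) \<in> (arcs_ends G)\<^sup>= O (arcs_ends G)\<^sup>= O (arcs_ends G)\<^sup>="
    and a: "a \<in> verts G" and b: "b \<in> verts G"
    and ge: "(a, b) \<notin> (arcs_ends G)\<^sup>= O (arcs_ends G)\<^sup>="
  shows "graph_diameter G = 3"
  unfolding graph_diameter_def
proof (rule antisym)
  show "(SUP u\<in>verts G. SUP v\<in>verts G. \<mu> (\<lambda>_. 1) u v) \<le> 3"
  proof (intro SUP_least)
    fix u v assume u: "u \<in> verts G" and v: "v \<in> verts G"
    obtain x y where xy: "(u, x) \<in> (arcs_ends G)\<^sup>=" "(x, y) \<in> (arcs_ends G)\<^sup>=" "(y, v) \<in> (arcs_ends G)\<^sup>="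
      using le[OF u v] by (auto elim!: relcompE)
    obtain p where p: "awalk u p x" "length p \<le> 1" using ex_awalk_reflcl[OF xy(1) u] by blast
    then obtain q where q: "awalk x q y" "length q \<le> 1" using ex_awalk_reflcl[OF xy(2)] by blast
    then obtain r where r: "awalk y r v" "length r \<le> 1" using ex_awalk_reflcl[OF xy(3)] by blast
    have "awalk u (p @ q @ r) v" using p q r by simp
    then have "\<mu> (\<lambda>_. 1) u v \<le> ereal (awalk_cost (\<lambda>_. 1) (p @ q @ r))"
      by (rule min_cost_le_walk_cost)
    also have "\<dots> \<le> ereal 3" using p q r by (simp add: awalk_cost_1)
    finally show "\<mu> (\<lambda>_. 1) u v \<le> 3" by simp
  qed
  have "3 \<le> \<mu> (\<lambda>_. 1) a b"
    unfolding \<mu>_def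
  proof (rule INF_greatest, clarify)
    fix p assume p: "awalk a p b"
    have E: "(tail G e, head G e) \<in> arcs_ends G" if "e \<in> arcs G" for e
      using that by (auto simp: arcs_ends_conv)
    have "3 \<le> length p"
    proof (rule ccontr)
      assume "\<not> 3 \<le> length p"
      then consider "p = []" | e where "p = [e]" | e f where "p = [e, f]"
        by (cases p; cases "tl p"; cases "tl (tl p)") auto
      then have "(a, b) \<in> (arcs_ends G)\<^sup>= O (arcs_ends G)\<^sup>="
      proof cases
        case 3
        then have "(a, head G e) \<in> arcs_ends G" "(head G e, b) \<in> arcs_ends G"
          using p E[of e] E[of f] by (auto simp: awalk_def)
        then show ?thesis by blast
      qed (use p E in \<open>auto simp: awalk_def\<close>)
      with ge show False ..
    qed
    then have "ereal 3 \<le> ereal (real (length p))" by (simp only: ereal_less_eq)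
    then show "3 \<le> ereal (awalk_cost (\<lambda>_. 1) p)" by (simp add: awalk_cost_1)
  qed
  then show "3 \<le> (SUP u\<in>verts G. SUP v\<in>verts G. \<mu> (\<lambda>_. 1) u v)"
    using a b by (meson SUP_upper2)
qed

section \<open>Vertices, arcs and characteristics of the graph\<close>

context cd_graph
begin

definition vertex_line :: "nat \<Rightarrow> nat \<Rightarrow> real \<Rightarrow> cd set" where
  "vertex_line m i s = cd_line (vertex m i s)"

lemma vertex_line_self: "vertex m i s \<in> vertex_line m i s"
  unfolding vertex_line_def cd_line_def by (metis cd_scale_one rangeI)

text \<open>First components are basis elements with coefficient one, which pins down the scaling
  factor and the index.\<close>

lemma vertex_line_eq_iff:
  assumes "m < 2 ^ n" "m' < 2 ^ n" "i < 2 ^ n" "k < 2 ^ n" "s \<in> {1, - 1}" "t \<in> {1, - 1}"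
  shows "vertex_line m i s = vertex_line m' k t \<longleftrightarrow> m = m' \<and> i = k \<and> s = t"
proof
  assume "vertex_line m i s = vertex_line m' k t"
  then obtain r where r: "vertex m i s = cd_scale r (vertex m' k t)"
    using vertex_line_self[of m i s] by (auto simp: vertex_line_def cd_line_def)
  then have "cd_scale 1 (cd_basis n i) = cd_scale r (cd_basis n k)"
    by (simp add: vertex_def cd_scale_one)
  then have "r = 1" "i = k" using assms by (simp_all add: cd_scale_basis_eq_iff)
  with r assms show "m = m' \<and> i = k \<and> s = t"
    by (auto simp: vertex_def cd_scale_scale cd_scale_basis_eq_iff xor_less_power2)
qed simp

lemma Gamma_e_verts_eq:
  "Gamma_e_verts \<gamma> n =
   {vertex_line m i s | m i s. m \<in> graph_indices \<and> i \<in> index_set m \<and> s \<in> {1, - 1}}"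
proof (intro equalityI subsetI)
  fix L assume "L \<in> Gamma_e_verts \<gamma> n"
  then obtain a b where ab: "a \<in> cd_E' n" "b \<in> cd_pmE n" "L = cd_line (Pr a b)"
    "cd_zero_divisor \<gamma> (Suc n) (Pr a b)"
    by (auto simp: Gamma_e_verts_def)
  obtain i where i: "a = cd_basis n i" "i < 2 ^ n" "i \<noteq> 0"
    using ab(1) by (auto simp: cd_E'_eq)
  obtain s j where sj: "b = cd_scale s (cd_basis n j)" "j < 2 ^ n" "s \<in> {1, - 1}"
    using ab(2) unfolding cd_pmE_eq by blast
  note ij = i(2,3) sj(2,3) and L = ab(3)[unfolded i(1) sj(1)] and zd = ab(4)[unfolded i(1) sj(1)]
  \<comment> \<open>The class of a pair of basis elements is the exclusive or of its two
    indices.\<close>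
  have "Pr (cd_basis n i) (cd_scale s (cd_basis n j)) = vertex (i XOR j) i s"
    by (simp add: vertex_def)
  with L zd ij zero_divisor_vertex_iff[of "i XOR j" i s]
  show "L \<in> {vertex_line m i s | m i s. m \<in> graph_indices \<and> i \<in> index_set m \<and> s \<in> {1, - 1}}"
    by (auto simp: vertex_line_def xor_less_power2)
next
  fix L assume "L \<in> {vertex_line m i s | m i s. m \<in> graph_indices \<and> i \<in> index_set m \<and> s \<in> {1, - 1}}"
  then obtain m i s where L: "L = vertex_line m i s" and mi: "m \<in> graph_indices" "i \<in> index_set m"
    and s: "s \<in> {1, - 1}" by auto
  then have lt: "m < 2 ^ n" "i < 2 ^ n" "i \<noteq> 0" by (auto simp: graph_indices_def index_set_def)
  have "cd_zero_divisor \<gamma> (Suc n) (vertex m i s)"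
    using zero_divisor_vertex_iff[OF lt s] mi by simp
  moreover have "cd_basis n i \<in> cd_E' n" using lt by (auto simp: cd_E'_eq)
  moreover have "cd_scale s (cd_basis n (i XOR m)) \<in> cd_pmE n"
    using lt s unfolding cd_pmE_eq by (blast intro: xor_less_power2)
  ultimately show "L \<in> Gamma_e_verts \<gamma> n"
    unfolding L vertex_line_def vertex_def Gamma_e_verts_def by blast
qed

text \<open>Arcs are defined through some pair of generators; orthogonality is homogeneous, so the
  standard ones can be tested.\<close>

lemma Gamma_e_arc_iff:
  assumes "m \<in> graph_indices" "m' \<in> graph_indices" "i \<in> index_set m" "k \<in> index_set m'"
    and s: "s \<in> {1, - 1}" "t \<in> {1, - 1}"
  shows "(vertex_line m i s, vertex_line m' k t) \<in> parcs (Gamma_e \<gamma> n) \<longleftrightarrow>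
    vertex_line m i s \<noteq> vertex_line m' k t \<and>
    m = m' \<and> s * t = edge_sign m i k \<and> edge_ind m i k = 1"
proof -
  let ?u = "vertex m i s" and ?v = "vertex m' k t"
  have lt: "m < 2 ^ n" "m' < 2 ^ n" "i < 2 ^ n" "k < 2 ^ n" "i \<noteq> 0" "k \<noteq> 0"
    using assms by (auto simp: graph_indices_def index_set_def)
  have mem: "vertex_line m i s \<in> Gamma_e_verts \<gamma> n" "vertex_line m' k t \<in> Gamma_e_verts \<gamma> n"
    using assms unfolding Gamma_e_verts_eq by blast+
  have "(\<exists>u v. vertex_line m i s = cd_line u \<and> vertex_line m' k t = cd_line v \<and>
          cd_orthogonal \<gamma> (Suc n) u v) \<longleftrightarrow> cd_orthogonal \<gamma> (Suc n) ?u ?v"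
  proof
    assume "\<exists>u v. vertex_line m i s = cd_line u \<and> vertex_line m' k t = cd_line v \<and>
      cd_orthogonal \<gamma> (Suc n) u v"
    then obtain u v where uv: "vertex_line m i s = cd_line u" "vertex_line m' k t = cd_line v"
      and orth: "cd_orthogonal \<gamma> (Suc n) u v" by blast
    obtain r r' where r: "?u = cd_scale r u" "?v = cd_scale r' v"
      using vertex_line_self[of m i s] vertex_line_self[of m' k t] uv by (auto simp: cd_line_def)
    \<comment> \<open>The generators are in turn multiples of the vertices, hence in the algebra, as
      homogeneity of the product requires.\<close>
    have "u \<in> cd_line ?u" "v \<in> cd_line ?v"
      using uv unfolding vertex_line_def cd_line_def by (metis cd_scale_one rangeI)+
    then have "u \<in> cd_carrier (Suc n)" "v \<in> cd_carrier (Suc n)"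
      using vertex_closed unfolding cd_line_def by (auto intro: cd_scale_closed simp del: cd_carrier.simps)
    then show "cd_orthogonal \<gamma> (Suc n) ?u ?v"
      using orth unfolding r cd_orthogonal_def by (simp only: cd_mult_scale cd_closed cd_scale_zero simp_thms)
  qed (unfold vertex_line_def, blast)
  then show ?thesis
    using mem cd_orthogonal_vertex_iff[OF lt s] by (simp add: Gamma_e_def)
qed

definition line_class :: "nat \<Rightarrow> cd set set" where
  "line_class m = {vertex_line m i s | i s. i \<in> index_set m \<and> s \<in> {1, - 1}}"

lemma pverts_Gamma_e: "pverts (Gamma_e \<gamma> n) = \<Union> (line_class ` graph_indices)"
  unfolding Gamma_e_def by (auto simp: Gamma_e_verts_eq line_class_def)

text \<open>Any representative of the line has the same \<open>m\<close> by
  \<open>vertex_line_eq_iff\<close>, so the definite description has a single value.\<close>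

lemma vertex_char_line:
  assumes "m \<in> graph_indices" "L \<in> line_class m"
  shows "vertex_char \<gamma> n L = chi m"
proof -
  obtain i s where L: "L = vertex_line m i s" and lt: "m < 2 ^ n" "i < 2 ^ n" "i \<noteq> 0"
    and s: "s \<in> {1, - 1}"
    using assms by (auto simp: graph_indices_def line_class_def index_set_def)
  \<comment> \<open>Norms are signs, so dividing is multiplying, and \<open>basis_norm_xor\<close>
    merges the two norms.\<close>
  have quot: "\<gamma> n * cd_norm \<gamma> n (cd_basis n i') / cd_norm \<gamma> n (cd_scale t (cd_basis n j)) = chi (i' XOR j)"
    if "i' < 2 ^ n" "j < 2 ^ n" "t \<in> {1, - 1}" for i' j t
    using that cd_norm_basis[of i' n 1 \<gamma>] cd_norm_basis[OF that(2,3), of \<gamma>]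
      basis_norm_cases[OF \<gamma>_less, of j] basis_norm_xor[OF \<gamma>_less, of i' j]
    by (auto simp: chi_def cd_scale_one)
  show ?thesis
    unfolding vertex_char_def
  proof (rule the_equality)
    have "cd_basis n i \<in> cd_E' n" "cd_scale s (cd_basis n (i XOR m)) \<in> cd_pmE n"
      using lt s unfolding cd_E'_eq cd_pmE_eq by (auto intro: xor_less_power2)
    moreover have "chi m = \<gamma> n * cd_norm \<gamma> n (cd_basis n i) / cd_norm \<gamma> n (cd_scale s (cd_basis n (i XOR m)))"
      using quot[of i "i XOR m" s] lt s by (simp add: xor_less_power2)
    ultimately show "\<exists>a\<in>cd_E' n. \<exists>b\<in>cd_pmE n. L = cd_line (Pr a b) \<and>
        chi m = \<gamma> n * cd_norm \<gamma> n a / cd_norm \<gamma> n b"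
      unfolding L vertex_line_def vertex_def by blast
  next
    fix c assume "\<exists>a\<in>cd_E' n. \<exists>b\<in>cd_pmE n. L = cd_line (Pr a b) \<and>
        c = \<gamma> n * cd_norm \<gamma> n a / cd_norm \<gamma> n b"
    then obtain a b where ab: "a \<in> cd_E' n" "b \<in> cd_pmE n" "L = cd_line (Pr a b)"
      "c = \<gamma> n * cd_norm \<gamma> n a / cd_norm \<gamma> n b" by blast
    obtain i' where i': "a = cd_basis n i'" "i' < 2 ^ n" using ab(1) by (auto simp: cd_E'_eq)
    obtain t j where tj: "b = cd_scale t (cd_basis n j)" "j < 2 ^ n" "t \<in> {1, - 1}"
      using ab(2) unfolding cd_pmE_eq by blast
    note ij = i'(2) tj(2,3) and L' = ab(3)[unfolded i'(1) tj(1)] and c = ab(4)[unfolded i'(1) tj(1)]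
    have "L = vertex_line (i' XOR j) i' t" by (simp add: L' vertex_line_def vertex_def)
    then have "m = i' XOR j"
      using L vertex_line_eq_iff[of m "i' XOR j" i i' s t] lt ij s by (simp add: xor_less_power2)
    then show "c = chi m" using c quot[OF ij] by simp
  qed
qed

lemma card_line_class:
  assumes "m \<in> graph_indices"
  shows "card (line_class m) = (if chi m = 1 then 2 ^ (n + 1) - 2 else 2 ^ (n + 1) - 4)"
proof -
  have m: "m < 2 ^ n" "chi m = - 1 \<Longrightarrow> m \<noteq> 0" using assms by (auto simp: graph_indices_def)
  have "line_class m = (\<lambda>(i, s). vertex_line m i s) ` (index_set m \<times> {1, - 1})"
    by (auto simp: line_class_def)
  moreover have "inj_on (\<lambda>(i, s). vertex_line m i s) (index_set m \<times> {1, - 1})"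
    using m by (auto simp: inj_on_def vertex_line_eq_iff index_set_def)
  ultimately have "card (line_class m) = 2 * card (index_set m)"
    by (simp add: card_image card_cartesian_product)
  moreover have "card (index_set m) = 2 ^ n - (if chi m = 1 then 1 else 2)"
  proof (cases "chi m = 1")
    case True
    then have "index_set m = {..<2 ^ n} - {0}" by (auto simp: index_set_def)
    then show ?thesis using True by simp
  next
    case False
    then have "index_set m = {..<2 ^ n} - {0, m}" "m \<noteq> 0"
      using m chi_cases[of m] by (auto simp: index_set_def)
    then show ?thesis using False m by (simp add: card_Diff_subset)
  qed
  ultimately show ?thesis by (simp add: diff_mult_distrib2)
qed

text \<open>Only \<open>m = 0\<close> can be missing, as \<open>chi 0\<close> is
  \<open>\<gamma> n\<close>.\<close>

lemma card_graph_indices: "card graph_indices = (if \<gamma> n = 1 then 2 ^ n else 2 ^ n - 1)"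
proof (cases "\<gamma> n = 1")
  case True
  then have "graph_indices = {..<2 ^ n}"
    by (auto simp: graph_indices_def chi_def basis_norm_def cnj_sign_def \<sigma>_0)
  then show ?thesis using True by simp
next
  case False
  then have "\<gamma> n = - 1" using \<gamma> by auto
  then have "graph_indices = {..<2 ^ n} - {0}"
    by (auto simp: graph_indices_def chi_def basis_norm_def cnj_sign_def \<sigma>_0)
  then show ?thesis using False by simp
qed

section \<open>The classes as connected components\<close>

definition component :: "nat \<Rightarrow> cd set pair_pre_digraph" where
  "component m = \<lparr> pverts = line_class m, parcs = {(L, M) \<in> parcs (Gamma_e \<gamma> n). L \<in> line_class m \<and> M \<in> line_class m} \<rparr>"

lemma wf_Gamma_e: "wf_digraph (with_proj (Gamma_e \<gamma> n))"
  by unfold_locales (auto simp: Gamma_e_def)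

lemma wf_component: "wf_digraph (with_proj (component m))"
  by unfold_locales (auto simp: component_def)

lemma induced_component:
  assumes "m \<in> graph_indices"
  shows "induced_subgraph (with_proj (component m)) (with_proj (Gamma_e \<gamma> n))"
  using wf_Gamma_e wf_component assms pverts_Gamma_e
  by (auto simp: induced_subgraph_def subgraph_def component_def)

lemma component_step:
  assumes "m \<in> graph_indices" "i \<in> index_set m" "k \<in> index_set m" "s \<in> {1, - 1}" "t \<in> {1, - 1}"
  shows "(vertex_line m i s, vertex_line m k t) \<in> (parcs (component m))\<^sup>= \<longleftrightarrow>
     i = k \<and> s = t \<or> s * t = edge_sign m i k \<and> edge_ind m i k = 1"
proof -
  have "vertex_line m i s = vertex_line m k t \<longleftrightarrow> i = k \<and> s = t"
    using assms by (intro vertex_line_eq_iff[THEN trans]) (auto simp: graph_indices_def index_set_def)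
  moreover have "vertex_line m i s \<in> line_class m" "vertex_line m k t \<in> line_class m"
    using assms by (auto simp: line_class_def)
  ultimately show ?thesis
    using Gamma_e_arc_iff[OF assms(1,1-5)] by (auto simp: component_def)
qed

lemma component_walk:
  assumes "m \<in> graph_indices" "L \<in> line_class m" "M \<in> line_class m"
  shows "(L, M) \<in> (parcs (component m))\<^sup>= O (parcs (component m))\<^sup>= O (parcs (component m))\<^sup>="
proof -
  obtain i s k t where L: "L = vertex_line m i s" and M: "M = vertex_line m k t"
    and ik: "i \<in> index_set m" "k \<in> index_set m" and st: "s \<in> {1, - 1}" "t \<in> {1, - 1}"
    using assms(2,3) by (auto simp: line_class_def)
  obtain q r where qr: "q \<in> index_set m" "r \<in> index_set m"
    and ind: "edge_ind m i q = 1" "edge_ind m q k = 1" "edge_ind m q r = 1" "edge_ind m r k = 1"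
    and sign: "edge_sign m q r * edge_sign m r k = - edge_sign m q k"
    using ex_midpoint[OF assms(1) ik] .
  have es: "edge_sign m i q \<in> {1, - 1}" "edge_sign m q k \<in> {1, - 1}" "edge_sign m q r \<in> {1, - 1}"
    using edge_sign_cases assms(1) ik qr by (simp_all add: graph_indices_def index_set_def)
  \<comment> \<open>Edges dictate the signs along the walk: \<open>?a\<close> at \<open>q\<close>,
    then \<open>?b\<close> at \<open>r\<close>.\<close>
  let ?a = "s * edge_sign m i q"
  let ?b = "?a * edge_sign m q r"
  have a: "?a \<in> {1, - 1}" and b: "?b \<in> {1, - 1}" using es st by auto
  have iq: "(L, vertex_line m q ?a) \<in> (parcs (component m))\<^sup>="
    unfolding L using component_step[OF assms(1) ik(1) qr(1) st(1) a] ind st by auto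
  show ?thesis
  \<comment> \<open>If the walk through \<open>q\<close> alone reaches index \<open>k\<close> with
    the wrong sign, the detour through \<open>r\<close> flips it.\<close>
  proof (cases "?a * t = edge_sign m q k")
    case True
    then have "(vertex_line m q ?a, M) \<in> (parcs (component m))\<^sup>="
      unfolding M using component_step[OF assms(1) qr(1) ik(2) a st(2)] ind by auto
    with iq show ?thesis by blast
  next
    case False
    have "(vertex_line m q ?a, vertex_line m r ?b) \<in> (parcs (component m))\<^sup>="
      using component_step[OF assms(1) qr a b] ind a by auto
    moreover have "?b * t = edge_sign m r k"
      using False sign es st by auto
    then have "(vertex_line m r ?b, M) \<in> (parcs (component m))\<^sup>="
      unfolding M using component_step[OF assms(1) qr(2) ik(2) b st(2)] ind by auto
    ultimately show ?thesis using iq by blast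
  qed
qed

lemma index_set_nonempty: "index_set m \<noteq> {}"
proof -
  obtain q where "q < 2 ^ n" "q \<notin> {0, m}"
    by (rule ex_fresh[of "{0, m}"]) (auto simp: card_insert_if)
  then show ?thesis by (auto simp: index_set_def)
qed

lemma line_class_nonempty: "line_class m \<noteq> {}"
proof -
  obtain i where "i \<in> index_set m" using index_set_nonempty by blast
  then have "vertex_line m i 1 \<in> line_class m" by (auto simp: line_class_def)
  then show ?thesis by blast
qed

text \<open>
  The sign of an edge depends only on its two indices, so the two lines with the same index are not
  adjacent and have no common neighbour.
\<close>

lemma diameter_component:
  assumes "m \<in> graph_indices"
  shows "graph_diameter (with_proj (component m)) = 3"
proof -
  obtain i where i: "i \<in> index_set m" using index_set_nonempty by blast
  show ?thesis
  proof (rule wf_digraph.graph_diameter_eq_3[OF wf_component])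
    show "(u, v) \<in> (arcs_ends (with_proj (component m)))\<^sup>= O (arcs_ends (with_proj (component m)))\<^sup>= O
        (arcs_ends (with_proj (component m)))\<^sup>="
      if "u \<in> verts (with_proj (component m))" "v \<in> verts (with_proj (component m))" for u v
      using component_walk[OF assms] that by (simp add: component_def)
    show "vertex_line m i 1 \<in> verts (with_proj (component m))"
      "vertex_line m i (- 1) \<in> verts (with_proj (component m))"
      using i by (auto simp: component_def line_class_def)
    show "(vertex_line m i 1, vertex_line m i (- 1)) \<notin>
      (arcs_ends (with_proj (component m)))\<^sup>= O (arcs_ends (with_proj (component m)))\<^sup>="
    proof
      assume "(vertex_line m i 1, vertex_line m i (- 1)) \<in>
        (arcs_ends (with_proj (component m)))\<^sup>= O (arcs_ends (with_proj (component m)))\<^sup>="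
      then obtain M where M: "(vertex_line m i 1, M) \<in> (parcs (component m))\<^sup>="
        "(M, vertex_line m i (- 1)) \<in> (parcs (component m))\<^sup>=" by auto
      then have "M \<in> line_class m" using i by (auto simp: component_def line_class_def)
      then obtain k t where kt: "M = vertex_line m k t" "k \<in> index_set m" "t \<in> {1, - 1}"
        by (auto simp: line_class_def)
      have "i = k \<and> 1 = t \<or> 1 * t = edge_sign m i k \<and> edge_ind m i k = 1"
        using M(1) component_step[OF assms i kt(2) _ kt(3), of 1] kt(1) by blast
      moreover have "k = i \<and> t = - 1 \<or> t * - 1 = edge_sign m i k \<and> edge_ind m k i = 1"
        using M(2) component_step[OF assms kt(2) i kt(3), of "- 1"] kt(1) edge_sign_commute[of m k i]
        by simp
      moreover have "edge_sign m i i = 1"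
        using edge_sign_self assms i by (simp add: graph_indices_def index_set_def)
      ultimately show False using kt(3) by auto
    qed
  qed
qed

lemma strongly_connected_component:
  assumes "m \<in> graph_indices"
  shows "strongly_connected (with_proj (component m))"
proof
  interpret C: wf_digraph "with_proj (component m)" by (rule wf_component)
  show "verts (with_proj (component m)) \<noteq> {}"
    using line_class_nonempty by (simp add: component_def)
  fix u v assume "u \<in> verts (with_proj (component m))" "v \<in> verts (with_proj (component m))"
  then have uv: "u \<in> verts (with_proj (component m))" "u \<in> line_class m" "v \<in> line_class m"
    by (auto simp: component_def)
  have step: "y \<in> verts (with_proj (component m)) \<and> x \<rightarrow>\<^sup>*\<^bsub>with_proj (component m)\<^esub> y"
    if "(x, y) \<in> (parcs (component m))\<^sup>=" "x \<in> verts (with_proj (component m))" for x y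
  proof (cases "x = y")
    case False
    then have "x \<rightarrow>\<^bsub>with_proj (component m)\<^esub> y" using that by simp
    then show ?thesis using C.adj_in_verts(2) C.reachable_adjI by blast
  qed (use that in simp)
  show "u \<rightarrow>\<^sup>*\<^bsub>with_proj (component m)\<^esub> v"
    using component_walk[OF assms uv(2,3)] step uv(1) by (auto 0 4 intro: C.reachable_trans)
qed

text \<open>Arcs preserve \<open>m\<close>, by \<open>Gamma_e_arc_iff\<close>.\<close>

lemma line_class_reachable:
  assumes "L \<rightarrow>\<^sup>*\<^bsub>with_proj (Gamma_e \<gamma> n)\<^esub> M" "L \<in> line_class m" "m \<in> graph_indices"
  shows "M \<in> line_class m"
proof -
  interpret G: wf_digraph "with_proj (Gamma_e \<gamma> n)" by (rule wf_Gamma_e)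
  show ?thesis
    using assms(1,2)
  proof (induction rule: G.reachable_induct)
    case (step x y)
    then have arc: "(x, y) \<in> parcs (Gamma_e \<gamma> n)" by simp
    then have "y \<in> pverts (Gamma_e \<gamma> n)" by (auto simp: Gamma_e_def)
    then obtain m' where m': "m' \<in> graph_indices" "y \<in> line_class m'"
      unfolding pverts_Gamma_e by blast
    have "x \<in> line_class m" by (rule step.IH[OF step.prems])
    then obtain i s where x: "x = vertex_line m i s" "i \<in> index_set m" "s \<in> {1, - 1}"
      unfolding line_class_def by blast
    obtain k t where y: "y = vertex_line m' k t" "k \<in> index_set m'" "t \<in> {1, - 1}"
      using m'(2) unfolding line_class_def by blast
    have "m = m'"
      using arc Gamma_e_arc_iff[OF assms(3) m'(1) x(2) y(2) x(3) y(3)] unfolding x y by blast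
    then show ?case using m'(2) by simp
  qed simp
qed

text \<open>Classes are strongly connected and closed under reachability, so a strongly connected
  induced subgraph stays within one class, and maximality makes it the whole class.\<close>

lemma Gamma_e_components_eq:
  "Gamma_e_components \<gamma> n = (\<lambda>m. with_proj (component m)) ` graph_indices"
proof (intro equalityI subsetI)
  fix H assume "H \<in> Gamma_e_components \<gamma> n"
  then have ind: "induced_subgraph H (with_proj (Gamma_e \<gamma> n))" and sc: "strongly_connected H"
    and max: "\<And>H'. induced_subgraph H' (with_proj (Gamma_e \<gamma> n)) \<Longrightarrow> strongly_connected H' \<Longrightarrow>
      \<not> verts H \<subset> verts H'"
    by (auto simp: Gamma_e_components_def pre_digraph.sccs_def)
  obtain L where L: "L \<in> verts H" using sc by (auto simp: strongly_connected_def)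
  have "verts H \<subseteq> pverts (Gamma_e \<gamma> n)" using ind by (auto simp: induced_subgraph_def subgraph_def)
  then obtain m where m: "m \<in> graph_indices" "L \<in> line_class m" using L pverts_Gamma_e by auto
  have "verts H \<subseteq> line_class m"
  proof
    fix M assume "M \<in> verts H"
    then have "L \<rightarrow>\<^sup>*\<^bsub>H\<^esub> M" using sc L by (auto simp: strongly_connected_def)
    then have "L \<rightarrow>\<^sup>*\<^bsub>with_proj (Gamma_e \<gamma> n)\<^esub> M"
      using ind by (auto intro: pre_digraph.reachable_mono simp: induced_subgraph_def)
    then show "M \<in> line_class m" using line_class_reachable m by blast
  qed
  then have v: "verts H = line_class m"
    using max[OF induced_component[OF m(1)] strongly_connected_component[OF m(1)]]
    by (auto simp: component_def)
  \<comment> \<open>An induced subgraph is determined by its vertices, with tail and head fixed by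
    \<open>compatible\<close>.\<close>
  have "H = with_proj (component m)"
    using ind v by (intro pre_digraph.equality)
      (auto simp: induced_subgraph_def subgraph_def compatible_def component_def)
  then show "H \<in> (\<lambda>m. with_proj (component m)) ` graph_indices" using m by blast
next
  fix H assume "H \<in> (\<lambda>m. with_proj (component m)) ` graph_indices"
  then obtain m where m: "m \<in> graph_indices" and H: "H = with_proj (component m)" by blast
  have "\<not> verts H \<subset> verts H'"
    if H': "induced_subgraph H' (with_proj (Gamma_e \<gamma> n))" "strongly_connected H'" for H'
  proof
    assume sub: "verts H \<subset> verts H'"
    obtain L where L: "L \<in> line_class m" using line_class_nonempty by blast
    then have "L \<in> verts H'" using sub by (auto simp: H component_def)
    have "verts H' \<subseteq> line_class m"
    proof
      fix M assume "M \<in> verts H'"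
      then have "L \<rightarrow>\<^sup>*\<^bsub>H'\<^esub> M" using H'(2) \<open>L \<in> verts H'\<close> by (auto simp: strongly_connected_def)
      then have "L \<rightarrow>\<^sup>*\<^bsub>with_proj (Gamma_e \<gamma> n)\<^esub> M"
        using H'(1) by (auto intro: pre_digraph.reachable_mono simp: induced_subgraph_def)
      then show "M \<in> line_class m" using line_class_reachable L m by blast
    qed
    then show False using sub by (auto simp: H component_def)
  qed
  then show "H \<in> Gamma_e_components \<gamma> n"
    using induced_component[OF m] strongly_connected_component[OF m] H
    by (auto simp: Gamma_e_components_def pre_digraph.sccs_def)
qed

lemma inj_on_component: "inj_on (\<lambda>m. with_proj (component m)) graph_indices"
proof (rule inj_onI)
  fix m m' assume m: "m \<in> graph_indices" "m' \<in> graph_indices"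
    and eq: "with_proj (component m) = with_proj (component m')"
  have "line_class m = line_class m'"
    using arg_cong[OF eq, of verts] by (simp add: component_def)
  moreover obtain i where i: "i \<in> index_set m" using index_set_nonempty by blast
  then have "vertex_line m i 1 \<in> line_class m" by (auto simp: line_class_def)
  ultimately have "vertex_line m i 1 \<in> line_class m'" by simp
  then obtain k t where "k \<in> index_set m'" "t \<in> {1, - 1}" "vertex_line m i 1 = vertex_line m' k t"
    unfolding line_class_def by blast
  then show "m = m'"
    using vertex_line_eq_iff[of m m' i k 1 t] m i by (auto simp: graph_indices_def index_set_def)
qed

end

theorem corollary4p9:
  fixes n :: nat and \<gamma> :: "nat \<Rightarrow> real"
  assumes "n \<ge> 3"
    and "\<forall>k\<le>n. \<gamma> k \<in> {1, - 1}"
  shows "(\<gamma> n = 1 \<longrightarrow> card (Gamma_e_components \<gamma> n) = 2 ^ n) \<and>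
         (\<gamma> n = - 1 \<longrightarrow> card (Gamma_e_components \<gamma> n) = 2 ^ n - 1) \<and>
         (\<forall>C\<in>Gamma_e_components \<gamma> n.
            graph_diameter C = 3 \<and>
            (component_char \<gamma> n C = 1 \<and> card (verts C) = 2 ^ (n + 1) - 2 \<or>
             component_char \<gamma> n C = - 1 \<and> card (verts C) = 2 ^ (n + 1) - 4))"
proof -
  interpret cd_graph \<gamma> n by unfold_locales fact+
  have "card (Gamma_e_components \<gamma> n) = (if \<gamma> n = 1 then 2 ^ n else 2 ^ n - 1)"
    by (simp add: Gamma_e_components_eq card_image inj_on_component card_graph_indices)
  moreover have "graph_diameter C = 3 \<and>
            (component_char \<gamma> n C = 1 \<and> card (verts C) = 2 ^ (n + 1) - 2 \<or>
             component_char \<gamma> n C = - 1 \<and> card (verts C) = 2 ^ (n + 1) - 4)"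
    if C_in: "C \<in> Gamma_e_components \<gamma> n" for C
  proof -
    obtain m where m: "m \<in> graph_indices" and C: "C = with_proj (component m)"
      using C_in unfolding Gamma_e_components_eq by blast
    have v: "verts C = line_class m" by (simp add: C component_def)
    \<comment> \<open>The image is a singleton since classes are nonempty, so
      \<open>the_elem\<close> in \<open>component_char\<close> returns \<open>chi m\<close>.\<close>
    have "vertex_char \<gamma> n ` verts C = {chi m}"
      using vertex_char_line[OF m] line_class_nonempty[of m] unfolding v by auto
    then have "component_char \<gamma> n C = chi m" by (simp add: component_char_def)
    moreover have "chi m \<in> {1, - 1}" using m by (intro chi_cases) (simp add: graph_indices_def)
    ultimately show ?thesis
      using card_line_class[OF m] diameter_component[OF m] C v by auto
  qed
  ultimately show ?thesis by auto
qed

end
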